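(* Let $L=L(G)$, let $L_\pm=L_\pm(G)$ be the standard splitting of $L$, and let $\{J_j\mid j\ge1\}$ be a vacuum sequence with $J_1=a\lambda$ for some regular $a\in\mathfrak g$. Let $G_a$ denote the subgroup of all $k\in G$ that commute with $a$. Then for every $k\in G_a$ and $f\in L_-$: (i) $kfk^{-1}\in L_-$; (ii) $u_{kfk^{-1}}=k\,u_f\,k^{-1}$; (iii) $(\ln\tau_f)_{t_1t_j}=(\ln\tau_{kfk^{-1}})_{t_1t_j}$ for all $j\ge1$. Here $u_f$ and $u_{kfk^{-1}}$ are the formal inverse scattering solutions, and $\tau_f,\tau_{kfk^{-1}}$ the tau functions, constructed from scattering data $f$ and $kfk^{-1}$ respectively.
   Context: $G$ is a complex semi-simple (matrix) Lie group with Lie algebra $\mathfrak g$ carrying an ad-invariant non-degenerate symmetric bilinear form $(\cdot,\cdot)$ (for classical algebras, $\mathrm{tr}(AB)$). $a\in\mathfrak g$ regular means that the centralizer of $a$ in $\mathfrak g$ is a Cartan subalgebra. $L(G)$ is the group of smooth loops $S^1\to G$, $\lambda$ the loop parameter, $\mathcal L$ its Lie algebra. Standard splitting: $L_+(G)$ is the subgroup of loops extending holomorphically to $|\lambda|<1$, and $L_-(G)$ the subgroup of loops extending holomorphically to $\infty\ge|\lambda|>1$ with value $\mathrm I$ at $\lambda=\infty$; then $\mathcal L_+=\{\sum_{j\ge0}A_j\lambda^j\}$, $\mathcal L_-=\{\sum_{j<0}A_j\lambda^j\}$, and $\xi_\pm$ are the projections. A vacuum sequence is a linearly independent commuting sequence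 in $\mathcal L_+$; it is assumed throughout that each $J_j=\phi_j(J_1)\lambda^{s(j)}$ for an analytic function $\phi_j$ and an integer $s(j)$. Put $V(t)=\exp\left(\sum_{j=1}^Nt_jJ_j\right)$ ($N$ arbitrary). For $f\in L_-$ and $t$ near $0\in\mathbb R^N$ factor $V(t)f^{-1}=M(t)^{-1}E(t)$, $M(t)\in L_-$, $E(t)\in L_+$. Then $u_f=(MJ_1M^{-1})_+-J_1$ and $\tau_f(t)=\mu(V(t)f^{-1})$. $\mu$-function: let $w(\xi,\eta)=\langle\partial_\lambda\xi,\eta\rangle_{-1}$, where $\langle\xi,\eta\rangle_k$ is the coefficient of $\lambda^k$ in $(\xi(\lambda),\eta(\lambda))$; this is a $2$-cocycle vanishing on $\mathcal L_\pm$, regarded also as a left invariant $2$-form on $L$, assumed to represent a class in $H^2(L,2\pi i\mathbb Z)$. On $(L_+L_-)\cap(L_-L_+)$ write uniquely $g=f_+f_-^{-1}=g_-^{-1}g_+$ with $f_\pm,g_\pm\in L_\pm$, and let $\gamma_\pm$ (resp. $\tilde\gamma_\pm$) be paths in $L_\pm$ from $e$ to $f_\pm$ (resp. $g_\pm$). Then $\mu(g)=\exp\left(\int_\Omega w\right)$, where $\Omega$ is any surface in $L$ whose oriented boundary is $\gamma_+*(f_+\gamma_-^{-1})$ followed by the reverse of $\tilde\gamma_-^{-1}*(g_-^{-1}\tilde\gamma_+)$. *)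

theory Defs
  imports
    "HOL-Analysis.Analysis"
    "HOL-Computational_Algebra.Polynomial"
begin

section \<open>Complex matrices and matrix Lie algebras\<close>

definition cscale :: "complex \<Rightarrow> complex^'n^'n \<Rightarrow> complex^'n^'n" where
  "cscale c A = (\<chi> i j. c * A $ i $ j)"

definition mat_power :: "complex^'n^'n \<Rightarrow> nat \<Rightarrow> complex^'n^'n" where
  "mat_power A m = (((**) A) ^^ m) (mat 1)"

definition mat_exp :: "complex^'n^'n \<Rightarrow> complex^'n^'n" where
  "mat_exp A = (\<Sum>m. (1 / fact m) *\<^sub>R mat_power A m)"

definition lie_bracket :: "complex^'n^'n \<Rightarrow> complex^'n^'n \<Rightarrow> complex^'n^'n" where
  "lie_bracket A B = A ** B - B ** A"

definition csubspace :: "(complex^'n^'n) set \<Rightarrow> bool" where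
  "csubspace S \<longleftrightarrow> 0 \<in> S \<and> (\<forall>x\<in>S. \<forall>y\<in>S. x + y \<in> S) \<and> (\<forall>c. \<forall>x\<in>S. cscale c x \<in> S)"

definition lie_algebra :: "(complex^'n^'n) set \<Rightarrow> (complex^'n^'n) set" where
  "lie_algebra G = {X. \<forall>t::real. mat_exp (t *\<^sub>R X) \<in> G}"

definition bracket_span ::
  "(complex^'n^'n) set \<Rightarrow> (complex^'n^'n) set \<Rightarrow> (complex^'n^'n) set" where
  "bracket_span S T = csubspace hull {lie_bracket x y | x y. x \<in> S \<and> y \<in> T}"

primrec derived_series :: "(complex^'n^'n) set \<Rightarrow> nat \<Rightarrow> (complex^'n^'n) set" where
  "derived_series S 0 = S"
| "derived_series S (Suc m) = bracket_span (derived_series S m) (derived_series S m)"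

primrec lower_central_series :: "(complex^'n^'n) set \<Rightarrow> nat \<Rightarrow> (complex^'n^'n) set" where
  "lower_central_series S 0 = S"
| "lower_central_series S (Suc m) = bracket_span S (lower_central_series S m)"

definition lie_ideal :: "(complex^'n^'n) set \<Rightarrow> (complex^'n^'n) set \<Rightarrow> bool" where
  "lie_ideal I g \<longleftrightarrow> csubspace I \<and> I \<subseteq> g \<and> (\<forall>x\<in>g. \<forall>y\<in>I. lie_bracket x y \<in> I)"

definition semisimple_lie_algebra :: "(complex^'n^'n) set \<Rightarrow> bool" where
  "semisimple_lie_algebra g \<longleftrightarrow>
     (\<forall>I. lie_ideal I g \<and> (\<exists>m. derived_series I m = {0}) \<longrightarrow> I = {0})"

definition cartan_subalgebra :: "(complex^'n^'n) set \<Rightarrow> (complex^'n^'n) set \<Rightarrow> bool" where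
  "cartan_subalgebra h g \<longleftrightarrow>
     csubspace h \<and> h \<subseteq> g \<and> (\<forall>x\<in>h. \<forall>y\<in>h. lie_bracket x y \<in> h) \<and>
     (\<exists>m. lower_central_series h m = {0}) \<and>
     {x \<in> g. \<forall>y\<in>h. lie_bracket x y \<in> h} = h"

definition regular_element :: "(complex^'n^'n) set \<Rightarrow> complex^'n^'n \<Rightarrow> bool" where
  "regular_element g a \<longleftrightarrow> a \<in> g \<and> cartan_subalgebra {x \<in> g. lie_bracket a x = 0} g"

text \<open>Semisimple groups are taken to be connected, as is implicit in the construction of
  the function \<open>mu\<close> below, which joins arbitrary elements of \<open>L_plus G\<close> to the identity.\<close>

definition complex_semisimple_matrix_group :: "(complex^'n^'n) set \<Rightarrow> bool" where
  "complex_semisimple_matrix_group G \<longleftrightarrow>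
     G \<subseteq> {A. invertible A} \<and> mat 1 \<in> G \<and>
     (\<forall>x\<in>G. \<forall>y\<in>G. x ** y \<in> G) \<and> (\<forall>x\<in>G. matrix_inv x \<in> G) \<and>
     closedin (top_of_set {A. invertible A}) G \<and> connected G \<and>
     csubspace (lie_algebra G) \<and> semisimple_lie_algebra (lie_algebra G)"

definition invariant_form ::
  "(complex^'n^'n) set \<Rightarrow> (complex^'n^'n \<Rightarrow> complex^'n^'n \<Rightarrow> complex) \<Rightarrow> bool" where
  "invariant_form g B \<longleftrightarrow>
     (\<forall>x\<in>g. \<forall>y\<in>g. \<forall>z\<in>g. B (x + y) z = B x z + B y z) \<and>
     (\<forall>c. \<forall>x\<in>g. \<forall>y\<in>g. B (cscale c x) y = c * B x y) \<and>
     (\<forall>x\<in>g. \<forall>y\<in>g. B x y = B y x) \<and>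
     (\<forall>x\<in>g. (\<forall>y\<in>g. B x y = 0) \<longrightarrow> x = 0) \<and>
     (\<forall>x\<in>g. \<forall>y\<in>g. \<forall>z\<in>g. B (lie_bracket x y) z + B y (lie_bracket x z) = 0)"

definition centralizer_in :: "(complex^'n^'n) set \<Rightarrow> complex^'n^'n \<Rightarrow> (complex^'n^'n) set" where
  "centralizer_in G a = {k \<in> G. k ** a = a ** k}"


section \<open>Loops\<close>

primrec Ck :: "nat \<Rightarrow> ('a::real_normed_vector \<Rightarrow> 'b::real_normed_vector) \<Rightarrow> bool" where
  "Ck 0 f \<longleftrightarrow> continuous_on UNIV f"
| "Ck (Suc m) f \<longleftrightarrow>
     (\<forall>x. f differentiable (at x)) \<and> (\<forall>v. Ck m (\<lambda>x. frechet_derivative f (at x) v))"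

definition smooth :: "('a::real_normed_vector \<Rightarrow> 'b::real_normed_vector) \<Rightarrow> bool" where
  "smooth f \<longleftrightarrow> (\<forall>m. Ck m f)"

text \<open>A loop on the unit circle is a \<open>2\<pi>\<close>-periodic function of the angle \<open>\<theta>\<close>; the loop
  parameter is \<open>\<lambda> = cis \<theta>\<close>.\<close>

type_synonym 'n loop = "real \<Rightarrow> complex^'n^'n"

definition smooth_loop :: "(complex^'n^'n) set \<Rightarrow> 'n loop \<Rightarrow> bool" where
  "smooth_loop S f \<longleftrightarrow> smooth f \<and> (\<forall>\<theta>. f (\<theta> + 2 * pi) = f \<theta>) \<and> (\<forall>\<theta>. f \<theta> \<in> S)"

definition loop_one :: "'n::finite loop" where
  "loop_one = (\<lambda>\<theta>. mat 1)"

definition loop_mult :: "'n::finite loop \<Rightarrow> 'n loop \<Rightarrow> 'n loop" where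
  "loop_mult f g = (\<lambda>\<theta>. f \<theta> ** g \<theta>)"

definition loop_inv :: "'n::finite loop \<Rightarrow> 'n loop" where
  "loop_inv f = (\<lambda>\<theta>. matrix_inv (f \<theta>))"

definition loop_conj :: "complex^'n^'n \<Rightarrow> 'n::finite loop \<Rightarrow> 'n loop" where
  "loop_conj k f = (\<lambda>\<theta>. k ** f \<theta> ** matrix_inv k)"

definition loop_group :: "(complex^'n^'n) set \<Rightarrow> 'n loop set" where
  "loop_group G = {f. smooth_loop G f}"

definition L_plus :: "(complex^'n^'n) set \<Rightarrow> 'n loop set" where
  "L_plus G = {f \<in> loop_group G. \<exists>F.
     continuous_on (cball 0 1) F \<and> (\<forall>z\<in>cball 0 1. F z \<in> G) \<and>
     (\<forall>i j. (\<lambda>z. F z $ i $ j) holomorphic_on ball 0 1) \<and> (\<forall>\<theta>. F (cis \<theta>) = f \<theta>)}"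

definition L_minus :: "(complex^'n^'n) set \<Rightarrow> 'n loop set" where
  "L_minus G = {f \<in> loop_group G. \<exists>F.
     continuous_on {z. 1 \<le> norm z} F \<and> (\<forall>z. 1 \<le> norm z \<longrightarrow> F z \<in> G) \<and>
     (\<forall>i j. (\<lambda>z. F z $ i $ j) holomorphic_on {z. 1 < norm z}) \<and>
     (F \<longlongrightarrow> mat 1) at_infinity \<and> (\<forall>\<theta>. F (cis \<theta>) = f \<theta>)}"

definition fourier_coeff :: "'n::finite loop \<Rightarrow> int \<Rightarrow> complex^'n^'n" where
  "fourier_coeff \<xi> m =
     (1 / (2 * pi)) *\<^sub>R integral {0..2 * pi} (\<lambda>\<theta>. cscale (cis (- of_int m * \<theta>)) (\<xi> \<theta>))"

definition loop_algebra_plus :: "(complex^'n^'n) set \<Rightarrow> 'n loop set" where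
  "loop_algebra_plus g = {\<xi>. smooth_loop g \<xi> \<and> (\<forall>m<0. fourier_coeff \<xi> m = 0)}"

definition plus_part :: "'n::finite loop \<Rightarrow> 'n loop" where
  "plus_part \<xi> = (\<lambda>\<theta>. \<Sum>m. cscale (cis (real m * \<theta>)) (fourier_coeff \<xi> (int m)))"


section \<open>Vacuum sequences\<close>

text \<open>\<open>is_matrix_function \<phi> A B\<close> says \<open>B = \<phi>(A)\<close> in the analytic functional calculus, given by
  Hermite interpolation: \<open>B = p(A)\<close> for a polynomial \<open>p\<close> agreeing with \<open>\<phi>\<close> on the spectrum of
  \<open>A\<close> together with all derivatives of order less than the matrix size. The value does not
  depend on \<open>p\<close>, and it is the sum of the power series of \<open>\<phi>\<close> at \<open>A\<close> where that converges.\<close>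

definition mat_spectrum :: "complex^'n^'n \<Rightarrow> complex set" where
  "mat_spectrum A = {z. \<not> invertible (A - mat z)}"

definition mat_poly :: "complex poly \<Rightarrow> complex^'n^'n \<Rightarrow> complex^'n^'n" where
  "mat_poly p A = (\<Sum>i\<le>degree p. cscale (coeff p i) (mat_power A i))"

definition is_matrix_function ::
  "(complex \<Rightarrow> complex) \<Rightarrow> complex^'n^'n \<Rightarrow> complex^'n^'n \<Rightarrow> bool" where
  "is_matrix_function \<phi> A B \<longleftrightarrow>
     (\<exists>p. B = mat_poly p A \<and>
        (\<forall>z\<in>mat_spectrum A. \<forall>i<CARD('n). (deriv ^^ i) \<phi> z = poly ((pderiv ^^ i) p) z))"

text \<open>Only the terms \<open>J j\<close> with \<open>j \<ge> 1\<close> belong to the sequence.\<close>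

definition vacuum_sequence :: "(complex^'n^'n) set \<Rightarrow> (nat \<Rightarrow> 'n loop) \<Rightarrow> bool" where
  "vacuum_sequence g J \<longleftrightarrow>
     (\<forall>j\<ge>1. J j \<in> loop_algebra_plus g) \<and>
     (\<forall>i\<ge>1. \<forall>j\<ge>1. \<forall>\<theta>. lie_bracket (J i \<theta>) (J j \<theta>) = 0) \<and>
     (\<forall>N c. (\<forall>\<theta>. (\<Sum>j=1..N. cscale (c j) (J j \<theta>)) = 0) \<longrightarrow> (\<forall>j\<in>{1..N}. c j = 0)) \<and>
     (\<forall>j\<ge>1. \<exists>\<phi> s. \<phi> analytic_on (\<Union>\<theta>. mat_spectrum (J 1 \<theta>)) \<and>
        (\<forall>\<theta>. \<exists>A. is_matrix_function \<phi> (J 1 \<theta>) A \<and> J j \<theta> = cscale (cis \<theta> powi s) A))"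


section \<open>The cocycle and its integrals over surfaces in the loop group\<close>

definition loop_deriv :: "'n::finite loop \<Rightarrow> 'n loop" where
  "loop_deriv \<xi> = (\<lambda>\<theta>. cscale (1 / (\<i> * cis \<theta>)) (vector_derivative \<xi> (at \<theta>)))"

definition loop_pairing ::
  "(complex^'n^'n \<Rightarrow> complex^'n^'n \<Rightarrow> complex) \<Rightarrow> int \<Rightarrow> 'n loop \<Rightarrow> 'n loop \<Rightarrow> complex" where
  "loop_pairing B m \<xi> \<eta> =
     (1 / (2 * pi)) *\<^sub>R integral {0..2 * pi} (\<lambda>\<theta>. cis (- of_int m * \<theta>) * B (\<xi> \<theta>) (\<eta> \<theta>))"

definition cocycle ::
  "(complex^'n^'n \<Rightarrow> complex^'n^'n \<Rightarrow> complex) \<Rightarrow> 'n loop \<Rightarrow> 'n loop \<Rightarrow> complex" where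
  "cocycle B \<xi> \<eta> = loop_pairing B (-1) (loop_deriv \<xi>) \<eta>"

text \<open>Smooth paths and squares in the loop group are restrictions to \<open>[0,1]\<close> and \<open>[0,1]\<^sup>2\<close> of
  smooth matrix valued maps; nothing is required of the values outside the interval or square.\<close>

definition smooth_path_in :: "'n::finite loop set \<Rightarrow> (real \<Rightarrow> 'n loop) \<Rightarrow> bool" where
  "smooth_path_in S p \<longleftrightarrow> smooth (\<lambda>(s, \<theta>). p s \<theta>) \<and> (\<forall>s\<in>{0..1}. p s \<in> S)"

definition smooth_square_in :: "'n::finite loop set \<Rightarrow> (real \<times> real \<Rightarrow> 'n loop) \<Rightarrow> bool" where
  "smooth_square_in S \<sigma> \<longleftrightarrow> smooth (\<lambda>(x, \<theta>). \<sigma> x \<theta>) \<and> (\<forall>x\<in>{0..1} \<times> {0..1}. \<sigma> x \<in> S)"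

text \<open>A surface is a finite list of smooth squares, glued along common edges: a compact oriented
  surface is cut into squares, and an oriented edge cancels against its reverse. Boundaries are
  therefore compared as formal integer combinations of oriented paths modulo
  \<open>p + reversepath p = 0\<close>. A disc is a single square, traversed counterclockwise.\<close>

definition path_chain :: "(real \<Rightarrow> 'n::finite loop) list \<Rightarrow> (real \<Rightarrow> 'n loop) \<Rightarrow> int" where
  "path_chain ps q =
     (let qs = map (\<lambda>p. restrict p {0..1}) ps
      in int (count_list qs q) - int (count_list qs (reversepath q)))"

definition square_edges :: "(real \<times> real \<Rightarrow> 'n::finite loop) \<Rightarrow> (real \<Rightarrow> 'n loop) list" where
  "square_edges \<sigma> =
     [\<lambda>s. \<sigma> (s, 0), \<lambda>t. \<sigma> (1, t), reversepath (\<lambda>s. \<sigma> (s, 1)), reversepath (\<lambda>t. \<sigma> (0, t))]"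

definition surface_in :: "'n::finite loop set \<Rightarrow> (real \<times> real \<Rightarrow> 'n loop) list \<Rightarrow> bool" where
  "surface_in S \<Omega> \<longleftrightarrow> (\<forall>\<sigma>\<in>set \<Omega>. smooth_square_in S \<sigma>)"

definition surface_boundary ::
  "(real \<times> real \<Rightarrow> 'n::finite loop) list \<Rightarrow> (real \<Rightarrow> 'n loop) \<Rightarrow> int" where
  "surface_boundary \<Omega> = path_chain (concat (map square_edges \<Omega>))"

text \<open>The left invariant 2-form determined by the cocycle, pulled back to a square.\<close>

definition cocycle_pullback ::
  "(complex^'n^'n \<Rightarrow> complex^'n^'n \<Rightarrow> complex) \<Rightarrow> (real \<times> real \<Rightarrow> 'n loop) \<Rightarrow>
     real \<times> real \<Rightarrow> complex" where
  "cocycle_pullback B \<sigma> = (\<lambda>(s, t). cocycle B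
     (\<lambda>\<theta>. matrix_inv (\<sigma> (s, t) \<theta>) ** vector_derivative (\<lambda>r. \<sigma> (r, t) \<theta>) (at s))
     (\<lambda>\<theta>. matrix_inv (\<sigma> (s, t) \<theta>) ** vector_derivative (\<lambda>r. \<sigma> (s, r) \<theta>) (at t)))"

definition surface_integral ::
  "(complex^'n^'n \<Rightarrow> complex^'n^'n \<Rightarrow> complex) \<Rightarrow> (real \<times> real \<Rightarrow> 'n loop) list \<Rightarrow> complex" where
  "surface_integral B \<Omega> =
     (\<Sum>\<sigma>\<leftarrow>\<Omega>. integral ({0..1} \<times> {0..1}) (cocycle_pullback B \<sigma>))"

text \<open>The 2-form represents a class in \<open>H\<^sup>2(L, 2\<pi>i\<int>)\<close>: its periods over closed surfaces lie in
  \<open>2\<pi>i\<int>\<close>.\<close>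

definition integral_class ::
  "(complex^'n^'n) set \<Rightarrow> (complex^'n^'n \<Rightarrow> complex^'n^'n \<Rightarrow> complex) \<Rightarrow> bool" where
  "integral_class G B \<longleftrightarrow>
     (\<forall>\<Omega>. surface_in (loop_group G) \<Omega> \<and> surface_boundary \<Omega> = (\<lambda>_. 0) \<longrightarrow>
        (\<exists>m::int. surface_integral B \<Omega> = 2 * pi * \<i> * of_int m))"

definition is_mu_value ::
  "(complex^'n^'n) set \<Rightarrow> (complex^'n^'n \<Rightarrow> complex^'n^'n \<Rightarrow> complex) \<Rightarrow>
     'n loop \<Rightarrow> complex \<Rightarrow> bool" where
  "is_mu_value G B g z \<longleftrightarrow>
     (\<exists>fp\<in>L_plus G. \<exists>fm\<in>L_minus G. \<exists>gp\<in>L_plus G. \<exists>gm\<in>L_minus G. \<exists>cp cm dp dm \<Omega>.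
        g = loop_mult fp (loop_inv fm) \<and> g = loop_mult (loop_inv gm) gp \<and>
        smooth_path_in (L_plus G) cp \<and> cp 0 = loop_one \<and> cp 1 = fp \<and>
        smooth_path_in (L_minus G) cm \<and> cm 0 = loop_one \<and> cm 1 = fm \<and>
        smooth_path_in (L_plus G) dp \<and> dp 0 = loop_one \<and> dp 1 = gp \<and>
        smooth_path_in (L_minus G) dm \<and> dm 0 = loop_one \<and> dm 1 = gm \<and>
        surface_in (loop_group G) \<Omega> \<and>
        surface_boundary \<Omega> = path_chain
          [cp, \<lambda>s. loop_mult fp (loop_inv (cm s)),
           reversepath (\<lambda>s. loop_mult (loop_inv gm) (dp s)),
           reversepath (\<lambda>s. loop_inv (dm s))] \<and>
        z = exp (surface_integral B \<Omega>))"

definition mu ::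
  "(complex^'n^'n) set \<Rightarrow> (complex^'n^'n \<Rightarrow> complex^'n^'n \<Rightarrow> complex) \<Rightarrow> 'n loop \<Rightarrow> complex" where
  "mu G B g = (THE z. is_mu_value G B g z)"


section \<open>Formal inverse scattering and tau functions\<close>

text \<open>\<open>\<real>\<^sup>N\<close> with coordinates \<open>t\<^sub>1, \<dots>, t\<^sub>N\<close>.\<close>

definition time_space :: "nat \<Rightarrow> (nat \<Rightarrow> real) set" where
  "time_space N = {t. \<forall>j. j \<notin> {1..N} \<longrightarrow> t j = 0}"

definition vacuum_flow :: "(nat \<Rightarrow> 'n::finite loop) \<Rightarrow> nat \<Rightarrow> (nat \<Rightarrow> real) \<Rightarrow> 'n loop" where
  "vacuum_flow J N t = (\<lambda>\<theta>. mat_exp (\<Sum>j=1..N. t j *\<^sub>R J j \<theta>))"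

definition is_factor ::
  "(complex^'n^'n) set \<Rightarrow> (nat \<Rightarrow> 'n loop) \<Rightarrow> nat \<Rightarrow> 'n loop \<Rightarrow> (nat \<Rightarrow> real) \<Rightarrow> 'n loop \<Rightarrow> bool" where
  "is_factor G J N f t M \<longleftrightarrow> M \<in> L_minus G \<and>
     (\<exists>E\<in>L_plus G. loop_mult (vacuum_flow J N t) (loop_inv f) = loop_mult (loop_inv M) E)"

text \<open>The set of all times at which the factorization exists; it is a neighbourhood of \<open>0\<close> in
  \<open>time_space N\<close>.\<close>

definition scattering_domain ::
  "(complex^'n^'n) set \<Rightarrow> (nat \<Rightarrow> 'n loop) \<Rightarrow> nat \<Rightarrow> 'n loop \<Rightarrow> (nat \<Rightarrow> real) set" where
  "scattering_domain G J N f = {t \<in> time_space N. \<exists>M. is_factor G J N f t M}"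

definition scattering_factor ::
  "(complex^'n^'n) set \<Rightarrow> (nat \<Rightarrow> 'n loop) \<Rightarrow> nat \<Rightarrow> 'n loop \<Rightarrow> (nat \<Rightarrow> real) \<Rightarrow> 'n loop" where
  "scattering_factor G J N f t = (THE M. is_factor G J N f t M)"

definition scattering_solution ::
  "(complex^'n^'n) set \<Rightarrow> (nat \<Rightarrow> 'n loop) \<Rightarrow> nat \<Rightarrow> 'n loop \<Rightarrow> (nat \<Rightarrow> real) \<Rightarrow> 'n loop" where
  "scattering_solution G J N f t =
     (let M = scattering_factor G J N f t
      in (\<lambda>\<theta>. plus_part (loop_mult (loop_mult M (J 1)) (loop_inv M)) \<theta> - J 1 \<theta>))"

definition tau ::
  "(complex^'n^'n) set \<Rightarrow> (complex^'n^'n \<Rightarrow> complex^'n^'n \<Rightarrow> complex) \<Rightarrow>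
     (nat \<Rightarrow> 'n loop) \<Rightarrow> nat \<Rightarrow> 'n loop \<Rightarrow> (nat \<Rightarrow> real) \<Rightarrow> complex" where
  "tau G B J N f t = mu G B (loop_mult (vacuum_flow J N t) (loop_inv f))"

definition has_partial_deriv ::
  "((nat \<Rightarrow> real) \<Rightarrow> complex) \<Rightarrow> nat \<Rightarrow> (nat \<Rightarrow> real) \<Rightarrow> complex \<Rightarrow> bool" where
  "has_partial_deriv F j t d \<longleftrightarrow>
     ((\<lambda>h. F (t(j := t j + h))) has_vector_derivative d) (at 0)"

text \<open>\<open>(ln T)\<close> has the second partial derivative \<open>d\<close> with respect to \<open>t\<^sub>i\<close> and then \<open>t\<^sub>j\<close> at \<open>t\<close>,
  where \<open>ln T\<close> is a continuous branch \<open>l\<close> of the logarithm of \<open>T\<close> near \<open>t\<close> in the domain \<open>D\<close> of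
  \<open>T\<close>. Since two branches differ by a locally constant function, \<open>d\<close> does not depend on \<open>l\<close>.\<close>

definition has_ln_second_partial ::
  "nat \<Rightarrow> (nat \<Rightarrow> real) set \<Rightarrow> ((nat \<Rightarrow> real) \<Rightarrow> complex) \<Rightarrow> nat \<Rightarrow> nat \<Rightarrow>
     (nat \<Rightarrow> real) \<Rightarrow> complex \<Rightarrow> bool" where
  "has_ln_second_partial N D T i j t d \<longleftrightarrow>
     (\<exists>W l l'. openin (top_of_set (time_space N)) W \<and> t \<in> W \<and> W \<subseteq> D \<and>
        continuous_on W l \<and> (\<forall>s\<in>W. exp (l s) = T s) \<and>
        (\<forall>s\<in>W. has_partial_deriv l i s (l' s)) \<and> has_partial_deriv l' j t d)"

end

theory Submission
  imports Defs "HOL-Complex_Analysis.Cauchy_Integral_Formula"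
begin

text \<open>Conjugation by a fixed \<open>k \<in> G\<close> preserves the loop groups \<open>L\<^sub>+\<close> and \<open>L\<^sub>-\<close>, and if \<open>k\<close> commutes
  with \<open>a\<close> it fixes every \<open>J\<^sub>j\<close>, hence \<open>V(t)\<close>. So \<open>V f\<^sup>-\<^sup>1 = M\<^sup>-\<^sup>1 E\<close> conjugates to the factorization
  for \<open>k f k\<^sup>-\<^sup>1\<close>, and as the factor \<open>M\<close> is unique, the scattering solutions are conjugate. The tau
  functions are even equal: conjugating a surface that computes \<open>\<mu>(g)\<close> gives one that computes
  \<open>\<mu>(k g k\<^sup>-\<^sup>1)\<close>, with the same integral because the form is invariant under \<open>Ad k\<close>. Only
  infinitesimal invariance is assumed; since a closed connected matrix group is generated by the
  exponentials of its Lie algebra, it integrates to invariance under all of \<open>G\<close>.\<close>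
section \<open>The Banach algebra of complex matrices\<close>

text \<open>Uniqueness of \<open>M\<close> is a Liouville argument: two factorizations give
  \<open>M2 M1^-1 = E2 E1^-1\<close> on the circle, a loop that extends inwards and also outwards
  with limit 1 at infinity. The extensions are only continuous up to the circle, so they are not
  glued there but compared through a reflected function and the mean value property.

  For \<open>mu\<close> the obstacle is that the form is an arbitrary function off the Lie algebra.
  Its invariance helps only where both arguments lie in \<open>lie_algebra G\<close>, so the left
  translated velocities of a square have to be placed there, even on the edges, beyond which the
  square may leave the group. Since \<open>lie_algebra G\<close> is defined by one parameter
  subgroups, this needs that limits of difference quotients of group elements at 1 belong to it. The
  same fact, \<open>lie_algebra_limit\<close>, is behind the generation of \<open>G\<close> by
  exponentials.\<close>

lemma bounded_bilinear_matrix_mult: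
  "bounded_bilinear ((**) :: complex^'n^'m \<Rightarrow> complex^'p^'n \<Rightarrow> complex^'p^'m)"
proof -
  have "bilinear ((**) :: complex^'n^'m \<Rightarrow> complex^'p^'n \<Rightarrow> complex^'p^'m)"
    unfolding bilinear_def
    by (auto intro!: linearI
        simp: vec_eq_iff matrix_matrix_mult_def ring_distribs sum.distrib scaleR_sum_right)
  then show ?thesis
    by (simp only: bilinear_conv_bounded_bilinear)
qed

lemma bounded_bilinear_matrix_vector_mult:
  "bounded_bilinear ((*v) :: complex^'n^'m \<Rightarrow> complex^'n \<Rightarrow> complex^'m)"
proof -
  have "bilinear ((*v) :: complex^'n^'m \<Rightarrow> complex^'n \<Rightarrow> complex^'m)"
    unfolding bilinear_def
    by (auto intro!: linearI
        simp: vec_eq_iff matrix_vector_mult_def ring_distribs sum.distrib scaleR_sum_right)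
  then show ?thesis
    by (simp only: bilinear_conv_bounded_bilinear)
qed

interpretation matmul: bounded_bilinear "(**) :: complex^'n^'m \<Rightarrow> complex^'p^'n \<Rightarrow> complex^'p^'m"
  by (rule bounded_bilinear_matrix_mult)

interpretation matvec: bounded_bilinear "(*v) :: complex^'n^'m \<Rightarrow> complex^'n \<Rightarrow> complex^'m"
  by (rule bounded_bilinear_matrix_vector_mult)

text \<open>On vectors \<open>*\<close> is componentwise, and \<open>mat 1\<close> does not have norm \<open>1\<close>. A copy of the matrix type
  with \<open>**\<close> and the operator norm is a Banach algebra, to which the library exponential applies.\<close>

typedef (overloaded) ('n::finite) cmat = "UNIV :: (complex^'n^'n) set"
  morphisms of_cmat cmat ..

setup_lifting type_definition_cmat

instantiation cmat :: (finite) real_normed_algebra_1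
begin

lift_definition zero_cmat :: "'a cmat" is 0 .
lift_definition one_cmat :: "'a cmat" is "mat 1" .
lift_definition plus_cmat :: "'a cmat \<Rightarrow> 'a cmat \<Rightarrow> 'a cmat" is "(+)" .
lift_definition minus_cmat :: "'a cmat \<Rightarrow> 'a cmat \<Rightarrow> 'a cmat" is "(-)" .
lift_definition uminus_cmat :: "'a cmat \<Rightarrow> 'a cmat" is uminus .
lift_definition times_cmat :: "'a cmat \<Rightarrow> 'a cmat \<Rightarrow> 'a cmat" is "(**)" .
lift_definition scaleR_cmat :: "real \<Rightarrow> 'a cmat \<Rightarrow> 'a cmat" is "(*\<^sub>R)" .
lift_definition norm_cmat :: "'a cmat \<Rightarrow> real" is "\<lambda>A. onorm ((*v) A)" .
definition dist_cmat :: "'a cmat \<Rightarrow> 'a cmat \<Rightarrow> real" where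
  "dist_cmat A B = norm (A - B)"
definition sgn_cmat :: "'a cmat \<Rightarrow> 'a cmat" where
  "sgn_cmat A = inverse (norm A) *\<^sub>R A"
definition uniformity_cmat :: "('a cmat \<times> 'a cmat) filter" where
  "uniformity_cmat = (INF e\<in>{0<..}. principal {(x, y). dist x y < e})"
definition open_cmat :: "'a cmat set \<Rightarrow> bool" where
  "open_cmat U \<longleftrightarrow> (\<forall>x\<in>U. \<forall>\<^sub>F (x', y) in uniformity. x' = x \<longrightarrow> y \<in> U)"

instance
proof
  fix a b c :: "'a cmat" and r s :: real and U :: "'a cmat set"
  show "a + b + c = a + (b + c)" by transfer (rule add.assoc)
  show "a + b = b + a" by transfer (rule add.commute)
  show "0 + a = a" by transfer simp
  show "- a + a = 0" by transfer simp
  show "a - b = a + - b" by transfer simp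
  show "a * b * c = a * (b * c)" by transfer (simp add: matrix_mul_assoc)
  show "1 * a = a" by transfer simp
  show "a * 1 = a" by transfer simp
  show "(a + b) * c = a * c + b * c" by transfer (rule matmul.add_left)
  show "a * (b + c) = a * b + a * c" by transfer (rule matmul.add_right)
  show "(0 :: 'a cmat) \<noteq> 1"
    by transfer (simp add: vec_eq_iff mat_def)
  show "r *\<^sub>R (a + b) = r *\<^sub>R a + r *\<^sub>R b" by transfer (rule scaleR_add_right)
  show "(r + s) *\<^sub>R a = r *\<^sub>R a + s *\<^sub>R a" by transfer (rule scaleR_add_left)
  show "r *\<^sub>R s *\<^sub>R a = (r * s) *\<^sub>R a" by transfer simp
  show "1 *\<^sub>R a = a" by transfer simp
  show "r *\<^sub>R a * b = r *\<^sub>R (a * b)" by transfer (rule matmul.scaleR_left)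
  show "a * r *\<^sub>R b = r *\<^sub>R (a * b)" by transfer (rule matmul.scaleR_right)
  show "dist a b = norm (a - b)" by (rule dist_cmat_def)
  show "sgn a = inverse (norm a) *\<^sub>R a" by (rule sgn_cmat_def)
  show "uniformity = (INF e\<in>{0<..}. principal {(x, y :: 'a cmat). dist x y < e})"
    by (rule uniformity_cmat_def)
  show "open U \<longleftrightarrow> (\<forall>x\<in>U. \<forall>\<^sub>F (x', y) in uniformity. x' = x \<longrightarrow> y \<in> U)"
    by (rule open_cmat_def)
  show "norm a = 0 \<longleftrightarrow> a = 0"
  proof transfer
    fix A :: "complex^'a^'a"
    have "(\<forall>x. A *v x = 0) \<longleftrightarrow> A = 0"
      by (metis matrix_eq matvec.zero_left)
    then show "onorm ((*v) A) = 0 \<longleftrightarrow> A = 0"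
      by (simp add: onorm_eq_0 matvec.bounded_linear_right)
  qed
  show "norm (a + b) \<le> norm a + norm b"
    by transfer
      (metis (no_types, lifting) ext matvec.add_left matvec.bounded_linear_right onorm_triangle)
  show "norm (r *\<^sub>R a) = \<bar>r\<bar> * norm a"
  proof transfer
    fix r :: real and A :: "complex^'a^'a"
    have "(*v) (r *\<^sub>R A) = (\<lambda>x. r *\<^sub>R (A *v x))"
      by (rule ext) (rule matvec.scaleR_left)
    then show "onorm ((*v) (r *\<^sub>R A)) = \<bar>r\<bar> * onorm ((*v) A)"
      by (simp add: onorm_scaleR[OF matvec.bounded_linear_right])
  qed
  show "norm (a * b) \<le> norm a * norm b"
  proof transfer
    fix A B :: "complex^'a^'a"
    have "(*v) (A ** B) = (*v) A \<circ> (*v) B"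
      by (auto simp: matrix_vector_mul_assoc)
    then show "onorm ((*v) (A ** B)) \<le> onorm ((*v) A) * onorm ((*v) B)"
      by (simp add: onorm_compose matvec.bounded_linear_right)
  qed
  show "norm (1 :: 'a cmat) = 1"
  proof transfer
    have "(*v) (mat 1 :: complex^'a^'a) = (\<lambda>x. x)"
      by auto
    then show "onorm ((*v) (mat 1 :: complex^'a^'a)) = 1"
      by (simp add: onorm_id)
  qed
qed

end

text \<open>Together with \<open>bounded_linear_of_cmat\<close> this is the equivalence of the
  operator norm and the Euclidean norm: limits, series and derivatives pass freely between the two
  types.\<close>

lemma bounded_linear_cmat: "bounded_linear cmat"
proof -
  obtain K where K: "\<And>(A :: complex^'a^'a) x. norm (A *v x) \<le> norm A * norm x * K" "0 \<le> K"
    using matvec.nonneg_bounded by blast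
  show ?thesis
  proof (rule bounded_linear_intro)
    fix A B :: "complex^'a^'a" and r :: real
    show "cmat (A + B) = cmat A + cmat B"
      by (simp add: plus_cmat.abs_eq)
    show "cmat (r *\<^sub>R A) = r *\<^sub>R cmat A"
      by (simp add: scaleR_cmat.abs_eq)
    show "norm (cmat A) \<le> norm A * K"
      by (simp add: norm_cmat.abs_eq) (rule onorm_le, metis K(1) mult.assoc mult.commute)
  qed
qed

lemma bounded_linear_of_cmat: "bounded_linear of_cmat"
proof (rule bounded_linear_intro)
  fix A B :: "'a cmat" and r :: real
  show "of_cmat (A + B) = of_cmat A + of_cmat B"
    by (rule plus_cmat.rep_eq)
  show "of_cmat (r *\<^sub>R A) = r *\<^sub>R of_cmat A"
    by (rule scaleR_cmat.rep_eq)
  have entry: "norm (of_cmat A $ i $ j) \<le> norm A" for i j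
  proof -
    have "norm (of_cmat A $ i $ j) = norm ((of_cmat A *v axis j 1) $ i)"
      by (simp add: matrix_vector_mul_component inner_axis' cart_eq_inner_axis
          matrix_vector_mult_def axis_def if_distrib cong: if_cong)
    also have "\<dots> \<le> norm (of_cmat A *v axis j 1)"
      by (rule Finite_Cartesian_Product.norm_nth_le)
    also have "\<dots> \<le> onorm ((*v) (of_cmat A)) * norm (axis j (1 :: complex))"
      by (rule onorm[OF matvec.bounded_linear_right])
    finally show ?thesis
      by (simp add: norm_cmat.rep_eq)
  qed
  have "norm (of_cmat A) \<le> (\<Sum>i\<in>UNIV. norm (of_cmat A $ i))"
    by (simp add: norm_vec_def L2_set_le_sum)
  also have "\<dots> \<le> (\<Sum>i\<in>UNIV. \<Sum>j\<in>UNIV. norm (of_cmat A $ i $ j))"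
    by (intro sum_mono) (simp add: norm_vec_def L2_set_le_sum)
  also have "\<dots> \<le> (\<Sum>i\<in>(UNIV::'a set). \<Sum>j\<in>(UNIV::'a set). norm A)"
    by (intro sum_mono entry)
  also have "\<dots> = norm A * (real CARD('a) * real CARD('a))"
    by simp
  finally show "norm (of_cmat A) \<le> norm A * (real CARD('a) * real CARD('a))" .
qed

instance cmat :: (finite) banach
proof
  fix X :: "nat \<Rightarrow> 'a cmat"
  assume "Cauchy X"
  then have "Cauchy (\<lambda>n. of_cmat (X n))"
    by (rule bounded_linear.Cauchy[OF bounded_linear_of_cmat])
  then obtain L where "(\<lambda>n. of_cmat (X n)) \<longlonglongrightarrow> L"
    using convergent_eq_Cauchy by blast
  from bounded_linear.tendsto[OF bounded_linear_cmat this] show "convergent X"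
    by (auto simp: of_cmat_inverse convergent_def)
qed

lemma of_cmat_cmat [simp]: "of_cmat (cmat A) = A"
  by (simp add: cmat_inverse)

lemma cmat_one: "cmat (mat 1) = 1"
  by (simp add: one_cmat.abs_eq)

lemma of_cmat_power: "of_cmat (X ^ m) = mat_power (of_cmat X) m"
  by (induction m) (simp_all add: mat_power_def one_cmat.rep_eq times_cmat.rep_eq)

lemma mat_exp_sums: "(\<lambda>m. (1 / fact m) *\<^sub>R mat_power A m) sums of_cmat (exp (cmat A))"
proof -
  have "(\<lambda>m. cmat A ^ m /\<^sub>R fact m) sums exp (cmat A)"
    by (rule exp_converges)
  from bounded_linear.sums[OF bounded_linear_of_cmat this] show ?thesis
    by (simp add: scaleR_cmat.rep_eq of_cmat_power inverse_eq_divide)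
qed

lemma mat_exp_eq: "mat_exp A = of_cmat (exp (cmat A))"
  unfolding mat_exp_def using mat_exp_sums by (rule sums_unique[symmetric])

lemma mat_exp_0: "mat_exp 0 = mat 1"
  by (simp add: mat_exp_eq zero_cmat.abs_eq[symmetric] one_cmat.rep_eq)

lemma mat_exp_scaleR_add: "mat_exp ((s + t) *\<^sub>R X) = mat_exp (s *\<^sub>R X) ** mat_exp (t *\<^sub>R X)"
proof -
  have "exp ((s + t) *\<^sub>R cmat X) = exp (s *\<^sub>R cmat X) * exp (t *\<^sub>R cmat X)"
    by (simp add: scaleR_add_left exp_add_commuting)
  then show ?thesis
    by (simp add: mat_exp_eq scaleR_cmat.abs_eq[symmetric] times_cmat.rep_eq[symmetric])
qed

lemma mat_exp_mult_minus: "mat_exp X ** mat_exp (- X) = mat 1"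
  using mat_exp_scaleR_add[of 1 "-1" X] by (simp add: mat_exp_0)

text \<open>Both placements of \<open>X\<close> are wanted: with \<open>X\<close> on the outer side
  of each exponential, the derivative of \<open>exp(tX) z exp(-tX)\<close> is at once the bracket of
  \<open>X\<close> with the curve itself.\<close>

lemma
  shows mat_exp_has_vector_derivative_left:
      "((\<lambda>t. mat_exp (t *\<^sub>R X)) has_vector_derivative X ** mat_exp (t *\<^sub>R X)) (at t)"
    and mat_exp_has_vector_derivative_right:
      "((\<lambda>t. mat_exp (t *\<^sub>R X)) has_vector_derivative mat_exp (t *\<^sub>R X) ** X) (at t)"
proof -
  have "((\<lambda>t. exp (t *\<^sub>R cmat X)) has_vector_derivative cmat X * exp (t *\<^sub>R cmat X)) (at t)"
    by (rule exp_scaleR_has_vector_derivative_left)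
  from bounded_linear.has_vector_derivative[OF bounded_linear_of_cmat this]
  show "((\<lambda>t. mat_exp (t *\<^sub>R X)) has_vector_derivative X ** mat_exp (t *\<^sub>R X)) (at t)"
    by (simp add: mat_exp_eq times_cmat.rep_eq scaleR_cmat.abs_eq[symmetric])
  have "((\<lambda>t. exp (t *\<^sub>R cmat X)) has_vector_derivative exp (t *\<^sub>R cmat X) * cmat X) (at t)"
    by (rule exp_scaleR_has_vector_derivative_right)
  from bounded_linear.has_vector_derivative[OF bounded_linear_of_cmat this]
  show "((\<lambda>t. mat_exp (t *\<^sub>R X)) has_vector_derivative mat_exp (t *\<^sub>R X) ** X) (at t)"
    by (simp add: mat_exp_eq times_cmat.rep_eq scaleR_cmat.abs_eq[symmetric])
qed

section \<open>Powers close to the exponential\<close>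

text \<open>Telescoping gives the exponent \<open>m - 1\<close>; \<open>1 \<le> K\<close> rounds it
  up to \<open>m\<close>. It is applied with \<open>K = exp (C * r)\<close> and
  \<open>m * r \<le> t\<close>, so that \<open>K ^ m\<close> stays below
  \<open>exp (C * t)\<close>.\<close>

lemma norm_power_diff_le:
  fixes a b :: "'a::real_normed_algebra_1"
  assumes "norm a \<le> K" "norm b \<le> K" "1 \<le> K"
  shows "norm (a ^ m - b ^ m) \<le> real m * norm (a - b) * K ^ m"
proof (induction m)
  case (Suc m)
  have "a ^ Suc m - b ^ Suc m = a * (a ^ m - b ^ m) + (a - b) * b ^ m"
    by (simp add: algebra_simps)
  also have "norm \<dots> \<le> norm (a * (a ^ m - b ^ m)) + norm ((a - b) * b ^ m)"
    by (rule norm_triangle_ineq)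
  also have "\<dots> \<le> K * (real m * norm (a - b) * K ^ m) + norm (a - b) * K ^ m"
  proof (intro add_mono)
    show "norm (a * (a ^ m - b ^ m)) \<le> K * (real m * norm (a - b) * K ^ m)"
      using Suc.IH assms by (intro order_trans[OF norm_mult_ineq] mult_mono) auto
    have "norm (b ^ m) \<le> K ^ m"
      using norm_power_ineq[of b m] power_mono[OF assms(2), of m] by simp
    then show "norm ((a - b) * b ^ m) \<le> norm (a - b) * K ^ m"
      by (intro order_trans[OF norm_mult_ineq] mult_left_mono) auto
  qed
  also have "\<dots> \<le> K * (real m * norm (a - b) * K ^ m) + K * (norm (a - b) * K ^ m)"
    using assms(3) mult_right_mono[of 1 K "norm (a - b) * K ^ m"] by simp
  also have "\<dots> = real (Suc m) * norm (a - b) * K ^ Suc m"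
    by (simp add: algebra_simps)
  finally show ?case .
qed simp

lemma has_vector_derivative_iff_quotient:
  "(f has_vector_derivative D) (at x) \<longleftrightarrow> ((\<lambda>h. (f (x + h) - f x) /\<^sub>R h) \<longlongrightarrow> D) (at 0)"
proof -
  have eq: "norm (f (x + h) - f x - h *\<^sub>R D) / norm h = norm ((f (x + h) - f x) /\<^sub>R h - D)"
    if "h \<noteq> 0" for h
  proof -
    have "(f (x + h) - f x) /\<^sub>R h - D = (f (x + h) - f x - h *\<^sub>R D) /\<^sub>R h"
      using that by (simp add: scaleR_diff_right)
    then show ?thesis
      by (simp add: divide_inverse mult.commute)
  qed
  have "(f has_vector_derivative D) (at x) \<longleftrightarrow>
      ((\<lambda>h. norm (f (x + h) - f x - h *\<^sub>R D) / norm h) \<longlongrightarrow> 0) (at 0)"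
    by (simp add: has_vector_derivative_def has_derivative_at bounded_linear_scaleR_left)
  also have "\<dots> \<longleftrightarrow> ((\<lambda>h. norm ((f (x + h) - f x) /\<^sub>R h - D)) \<longlongrightarrow> 0) (at 0)"
    by (intro filterlim_cong refl eventually_at_filter[THEN iffD2] always_eventually) (use eq in blast)
  also have "\<dots> \<longleftrightarrow> ((\<lambda>h. (f (x + h) - f x) /\<^sub>R h) \<longlongrightarrow> D) (at 0)"
    by (simp add: tendsto_norm_zero_iff LIM_zero_iff)
  finally show ?thesis .
qed

lemma has_vector_derivative_quotient_sequentially:
  assumes "(f has_vector_derivative D) (at x)" "\<And>n. r n \<noteq> 0" "r \<longlonglongrightarrow> 0"
  shows "(\<lambda>n. (f (x + r n) - f x) /\<^sub>R r n) \<longlonglongrightarrow> D"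
  using assms(2,3)
  by (intro filterlim_compose[OF assms(1)[unfolded has_vector_derivative_iff_quotient]])
    (auto simp: filterlim_at)

lemma exp_scaleR_of_nat:
  fixes x :: "'a::{real_normed_algebra_1,banach}"
  shows "exp (real m *\<^sub>R x) = exp x ^ m"
proof (induction m)
  case (Suc m)
  have "exp (real (Suc m) *\<^sub>R x) = exp x * exp (real m *\<^sub>R x)"
    by (subst exp_add_commuting[symmetric]) (simp_all add: scaleR_left_distrib)
  with Suc show ?case by simp
qed simp

text \<open>A form of \<open>(1 + Y/n)^n \<rightarrow> exp Y\<close>. The factors \<open>h n\<close>
  and \<open>exp (r n *\<^sub>R Y)\<close> differ by \<open>o(r n)\<close>, and about
  \<open>t / r n\<close> of them are multiplied, so the powers differ by \<open>o(1)\<close>; the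
  powers of the exponential are explicit.\<close>

lemma tendsto_power_exp:
  fixes h :: "nat \<Rightarrow> 'a::{real_normed_algebra_1,banach}"
  assumes r: "\<And>n. r n > 0" "r \<longlonglongrightarrow> 0"
    and h: "(\<lambda>n. (h n - 1) /\<^sub>R r n) \<longlonglongrightarrow> Y" and t: "t \<ge> 0"
  shows "(\<lambda>n. h n ^ nat \<lfloor>t / r n\<rfloor>) \<longlonglongrightarrow> exp (t *\<^sub>R Y)"
proof -
  define m where "m n = nat \<lfloor>t / r n\<rfloor>" for n
  have m_le: "real (m n) * r n \<le> t" for n
  proof -
    have "real (m n) \<le> t / r n"
      unfolding m_def using r(1)[of n] t by (intro of_nat_floor) simp
    then show ?thesis
      using r(1)[of n] by (simp add: pos_le_divide_eq)
  qed
  have m_ge: "t - r n \<le> real (m n) * r n" for n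
  proof -
    have "t / r n - 1 \<le> real (m n)"
      unfolding m_def using r(1)[of n] t by linarith
    then have "(t / r n - 1) * r n \<le> real (m n) * r n"
      using r(1)[of n] by (intro mult_right_mono) auto
    then show ?thesis
      using r(1)[of n] by (simp add: left_diff_distrib)
  qed
  have "(\<lambda>n. t - r n) \<longlonglongrightarrow> t"
    using tendsto_diff[OF tendsto_const r(2), of t] by simp
  then have m_lim: "(\<lambda>n. real (m n) * r n) \<longlonglongrightarrow> t"
    by (rule real_tendsto_sandwich[OF _ _ _ tendsto_const, rotated -1])
      (intro always_eventually allI m_ge m_le)+
  have "Bseq (\<lambda>n. (h n - 1) /\<^sub>R r n)"
    using h by (intro convergent_imp_Bseq) (auto simp: convergent_def)
  then obtain C0 where C0: "\<And>n. norm ((h n - 1) /\<^sub>R r n) \<le> C0" "C0 > 0"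
    by (elim BseqE) blast
  \<comment> \<open>One constant for both factors: \<open>h n\<close> and
    \<open>exp (r n *\<^sub>R Y)\<close> then have norm at most
    \<open>exp (C * r n)\<close>.\<close>
  define C where "C = max C0 (norm Y)"
  have hK: "norm (h n) \<le> exp (C * r n)" for n
  proof -
    have "norm (h n - 1) \<le> C0 * r n"
      using C0(1)[of n] r(1)[of n]
      by (simp add: divide_inverse[symmetric] pos_divide_le_eq mult.commute[of "inverse _"])
    then have "norm (h n) \<le> 1 + C0 * r n"
      using norm_triangle_ineq[of "h n - 1" 1] by simp
    also have "\<dots> \<le> 1 + C * r n"
      using r(1)[of n] by (simp add: C_def)
    also have "\<dots> \<le> exp (C * r n)"
      by (rule exp_ge_add_one_self)
    finally show ?thesis .
  qed
  have eK: "norm (exp (r n *\<^sub>R Y)) \<le> exp (C * r n)" for n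
  proof -
    have "norm (exp (r n *\<^sub>R Y)) \<le> exp (norm (r n *\<^sub>R Y))"
      by (rule norm_exp)
    also have "\<dots> \<le> exp (C * r n)"
      using r(1)[of n] by (simp add: C_def mult.commute)
    finally show ?thesis .
  qed
  have "((\<lambda>t. exp (t *\<^sub>R Y)) has_vector_derivative exp (0 *\<^sub>R Y) * Y) (at 0)"
    by (rule exp_scaleR_has_vector_derivative_right)
  from has_vector_derivative_quotient_sequentially[OF this _ r(2)]
  have exp_lim: "(\<lambda>n. (exp (r n *\<^sub>R Y) - 1) /\<^sub>R r n) \<longlonglongrightarrow> Y"
    using r(1) by (simp add: less_imp_neq[symmetric])
  have "(\<lambda>n. norm ((h n - 1) /\<^sub>R r n - (exp (r n *\<^sub>R Y) - 1) /\<^sub>R r n)) \<longlonglongrightarrow> norm (Y - Y)"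
    by (intro tendsto_intros h exp_lim)
  then have "(\<lambda>n. t * norm ((h n - 1) /\<^sub>R r n - (exp (r n *\<^sub>R Y) - 1) /\<^sub>R r n) * exp (C * t))
      \<longlonglongrightarrow> t * norm (Y - Y) * exp (C * t)"
    by (intro tendsto_intros h exp_lim)
  then have diff_lim: "(\<lambda>n. t * norm ((h n - 1) /\<^sub>R r n - (exp (r n *\<^sub>R Y) - 1) /\<^sub>R r n) * exp (C * t))
      \<longlonglongrightarrow> 0"
    by simp
  have "norm (h n ^ m n - exp (r n *\<^sub>R Y) ^ m n)
      \<le> t * norm ((h n - 1) /\<^sub>R r n - (exp (r n *\<^sub>R Y) - 1) /\<^sub>R r n) * exp (C * t)" for n
  proof -
    have C_pos: "C > 0"
      using C0(2) by (simp add: C_def)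
    have "norm (h n ^ m n - exp (r n *\<^sub>R Y) ^ m n)
        \<le> real (m n) * norm (h n - exp (r n *\<^sub>R Y)) * exp (C * r n) ^ m n"
      using C_pos r(1)[of n] by (intro norm_power_diff_le hK eK) simp
    also have "\<dots> = (real (m n) * r n) * norm ((h n - 1) /\<^sub>R r n - (exp (r n *\<^sub>R Y) - 1) /\<^sub>R r n)
        * exp (C * (real (m n) * r n))"
    proof -
      have "(h n - 1) /\<^sub>R r n - (exp (r n *\<^sub>R Y) - 1) /\<^sub>R r n = (h n - exp (r n *\<^sub>R Y)) /\<^sub>R r n"
        by (simp add: scaleR_diff_right[symmetric])
      then have "norm (h n - exp (r n *\<^sub>R Y))
          = r n * norm ((h n - 1) /\<^sub>R r n - (exp (r n *\<^sub>R Y) - 1) /\<^sub>R r n)"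
        using r(1)[of n] by simp
      moreover have "exp (C * r n) ^ m n = exp (C * (real (m n) * r n))"
        by (simp only: exp_of_nat_mult[symmetric] mult.left_commute)
      ultimately show ?thesis
        by (simp only: mult.assoc)
    qed
    also have "\<dots> \<le> t * norm ((h n - 1) /\<^sub>R r n - (exp (r n *\<^sub>R Y) - 1) /\<^sub>R r n) * exp (C * t)"
      using C_pos m_le[of n] t r(1)[of n] by (intro mult_mono mult_nonneg_nonneg) auto
    finally show ?thesis .
  qed
  then have "(\<lambda>n. h n ^ m n - exp (r n *\<^sub>R Y) ^ m n) \<longlonglongrightarrow> 0"
    by (intro Lim_null_comparison[OF _ diff_lim] always_eventually allI)
  moreover have "(\<lambda>n. exp (r n *\<^sub>R Y) ^ m n) \<longlonglongrightarrow> exp (t *\<^sub>R Y)"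
  proof -
    have "exp (r n *\<^sub>R Y) ^ m n = exp ((real (m n) * r n) *\<^sub>R Y)" for n
    proof -
      have "exp (r n *\<^sub>R Y) ^ m n = exp (real (m n) *\<^sub>R r n *\<^sub>R Y)"
        by (rule exp_scaleR_of_nat[symmetric])
      also have "real (m n) *\<^sub>R r n *\<^sub>R Y = (real (m n) * r n) *\<^sub>R Y"
        by simp
      finally show ?thesis .
    qed
    moreover have "isCont (\<lambda>t. exp (t *\<^sub>R Y)) t"
      by (rule has_vector_derivative_continuous[OF exp_scaleR_has_vector_derivative_right])
    ultimately show ?thesis
      using isCont_tendsto_compose[OF _ m_lim] by simp
  qed
  ultimately have "(\<lambda>n. h n ^ m n - exp (r n *\<^sub>R Y) ^ m n + exp (r n *\<^sub>R Y) ^ m n)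
      \<longlonglongrightarrow> 0 + exp (t *\<^sub>R Y)"
    by (rule tendsto_add)
  then show ?thesis
    by (simp add: m_def)
qed

section \<open>The matrix inverse\<close>

lemma matrix_inv:
  fixes A :: "'a::semiring_1^'n^'m"
  assumes "invertible A"
  shows "A ** matrix_inv A = mat 1" "matrix_inv A ** A = mat 1"
  using someI_ex[of "\<lambda>B. A ** B = mat 1 \<and> B ** A = mat 1"] assms
  unfolding invertible_def matrix_inv_def by auto

lemma matrix_inv_unique:
  fixes A :: "'a::semiring_1^'n^'m"
  assumes "A ** B = mat 1" "B ** A = mat 1"
  shows "matrix_inv A = B"
proof -
  have "invertible A"
    using assms by (auto simp: invertible_def)
  then have "matrix_inv A = matrix_inv A ** (A ** B)"
    using assms by simp
  also have "\<dots> = B"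
    using matrix_inv[OF \<open>invertible A\<close>] by (simp add: matrix_mul_assoc)
  finally show ?thesis .
qed

lemma invertible_matrix_inv: "invertible A \<Longrightarrow> invertible (matrix_inv A)"
  using matrix_inv[of A] by (auto simp: invertible_def)

lemma matrix_inv_matrix_inv: "invertible A \<Longrightarrow> matrix_inv (matrix_inv A) = A"
  by (simp add: matrix_inv matrix_inv_unique)

lemma matrix_inv_mult:
  fixes A B :: "'a::semiring_1^'n^'n"
  assumes "invertible A" "invertible B"
  shows "matrix_inv (A ** B) = matrix_inv B ** matrix_inv A"
proof (rule matrix_inv_unique)
  have "A ** B ** (matrix_inv B ** matrix_inv A) = A ** (B ** matrix_inv B) ** matrix_inv A"
    by (simp add: matrix_mul_assoc)
  then show "A ** B ** (matrix_inv B ** matrix_inv A) = mat 1"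
    by (simp add: matrix_inv assms)
  have "matrix_inv B ** matrix_inv A ** (A ** B) = matrix_inv B ** (matrix_inv A ** A) ** B"
    by (simp add: matrix_mul_assoc)
  then show "matrix_inv B ** matrix_inv A ** (A ** B) = mat 1"
    by (simp add: matrix_inv assms)
qed

lemma matrix_inv_mat_exp: "matrix_inv (mat_exp X) = mat_exp (- X)"
  using mat_exp_mult_minus[of X] mat_exp_mult_minus[of "- X"] by (simp add: matrix_inv_unique)

text \<open>Cramer's rule for each column of the inverse. Entries of the inverse become quotients of
  polynomials in the entries of \<open>A\<close>, which is the source of both its continuity and its
  holomorphy.\<close>

lemma matrix_inv_nth:
  fixes A :: "'a::field^'n^'n"
  assumes "invertible A"
  shows "matrix_inv A $ k $ l =
    det (\<chi> i j. if j = k then axis l 1 $ i else A $ i $ j) / det A"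
proof -
  have "A *v column l (matrix_inv A) = column l (A ** matrix_inv A)"
    by (simp add: vec_eq_iff column_def matrix_vector_mult_def matrix_matrix_mult_def)
  also have "\<dots> = axis l 1"
    by (simp add: matrix_inv assms vec_eq_iff column_def axis_def mat_def)
  finally have "column l (matrix_inv A) =
      (\<chi> k. det (\<chi> i j. if j = k then axis l 1 $ i else A $ i $ j) / det A)"
    using assms by (subst (asm) cramer) (simp_all add: invertible_det_nz)
  then show ?thesis
    by (simp add: vec_eq_iff column_def)
qed

lemma tendsto_det:
  fixes f :: "'a \<Rightarrow> 'b::real_normed_field^'n^'n"
  assumes "\<And>i j. ((\<lambda>x. f x $ i $ j) \<longlongrightarrow> A $ i $ j) F"
  shows "((\<lambda>x. det (f x)) \<longlongrightarrow> det A) F"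
  unfolding det_def by (intro tendsto_intros assms)

lemma tendsto_matrix_inv:
  fixes f :: "'a \<Rightarrow> complex^'n^'n"
  assumes "(f \<longlongrightarrow> A) F" "\<forall>\<^sub>F x in F. invertible (f x)" "invertible A"
  shows "((\<lambda>x. matrix_inv (f x)) \<longlongrightarrow> matrix_inv A) F"
proof (intro vec_tendstoI)
  fix k l
  have nth: "((\<lambda>x. f x $ i $ j) \<longlongrightarrow> A $ i $ j) F" for i j
    by (intro tendsto_vec_nth assms(1))
  have "((\<lambda>x. det (\<chi> i j. if j = k then axis l 1 $ i else f x $ i $ j) / det (f x)) \<longlongrightarrow>
      matrix_inv A $ k $ l) F"
    unfolding matrix_inv_nth[OF assms(3)]
    using assms(3) by (intro tendsto_divide tendsto_det nth) (auto simp: invertible_det_nz nth)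
  then show "((\<lambda>x. matrix_inv (f x) $ k $ l) \<longlongrightarrow> matrix_inv A $ k $ l) F"
    by (rule Lim_transform_eventually)
      (rule eventually_mono[OF assms(2)], simp add: matrix_inv_nth)
qed

lemma continuous_on_matrix_inv:
  fixes f :: "'a::topological_space \<Rightarrow> complex^'n^'n"
  assumes "continuous_on S f" "\<And>x. x \<in> S \<Longrightarrow> invertible (f x)"
  shows "continuous_on S (\<lambda>x. matrix_inv (f x))"
  using assms unfolding continuous_on_def
  by (auto intro!: tendsto_matrix_inv simp: eventually_at_filter)

section \<open>Conjugation of matrix powers and exponentials\<close>

lemma mat_power_conj:
  assumes "invertible k"
  shows "mat_power (k ** A ** matrix_inv k) m = k ** mat_power A m ** matrix_inv k"
proof (induction m)
  case (Suc m)
  have "k ** A ** matrix_inv k ** (k ** X ** matrix_inv k)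
      = k ** A ** (matrix_inv k ** k) ** X ** matrix_inv k" for X
    by (simp add: matrix_mul_assoc)
  with Suc show ?case
    by (simp add: mat_power_def matrix_inv assms matrix_mul_assoc)
qed (simp add: mat_power_def matrix_inv assms)

lemma bounded_linear_conj:
  "bounded_linear (\<lambda>A :: complex^'n^'n. k ** A ** l)"
  by (intro bounded_linear_compose[OF matmul.bounded_linear_left]
      matmul.bounded_linear_right)

lemma mat_exp_conj:
  assumes "invertible k"
  shows "mat_exp (k ** A ** matrix_inv k) = k ** mat_exp A ** matrix_inv k"
proof (rule sums_unique2)
  have "(\<lambda>m. (1 / fact m) *\<^sub>R mat_power (k ** A ** matrix_inv k) m)
      sums mat_exp (k ** A ** matrix_inv k)"
    unfolding mat_exp_eq by (rule mat_exp_sums)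
  then show "(\<lambda>m. k ** ((1 / fact m) *\<^sub>R mat_power A m) ** matrix_inv k)
      sums mat_exp (k ** A ** matrix_inv k)"
    by (simp add: mat_power_conj assms matmul.scaleR_left matmul.scaleR_right)
  have "(\<lambda>m. (1 / fact m) *\<^sub>R mat_power A m) sums mat_exp A"
    unfolding mat_exp_eq by (rule mat_exp_sums)
  then show "(\<lambda>m. k ** ((1 / fact m) *\<^sub>R mat_power A m) ** matrix_inv k)
      sums (k ** mat_exp A ** matrix_inv k)"
    by (rule bounded_linear.sums[OF bounded_linear_conj])
qed

section \<open>Closed matrix groups and their Lie algebras\<close>

lemma derivative_in_closed_subspace:
  assumes "(f has_vector_derivative D) (at x)" "\<And>y. f y \<in> S" "subspace S" "closed S"
  shows "D \<in> S"
proof (rule closed_sequentially[OF assms(4)])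
  show "(\<lambda>n. (f (x + 1 / Suc n) - f x) /\<^sub>R (1 / Suc n)) \<longlonglongrightarrow> D"
    using LIMSEQ_Suc[OF lim_inverse_n']
    by (intro has_vector_derivative_quotient_sequentially assms) auto
  show "(f (x + 1 / Suc n) - f x) /\<^sub>R (1 / Suc n) \<in> S" for n
    using assms by (intro subspace_scale subspace_diff) auto
qed

locale closed_matrix_group =
  fixes G :: "(complex^'n^'n) set"
  assumes invertible: "A \<in> G \<Longrightarrow> invertible A"
    and one_mem: "mat 1 \<in> G"
    and mult_mem: "A \<in> G \<Longrightarrow> C \<in> G \<Longrightarrow> A ** C \<in> G"
    and inv_mem: "A \<in> G \<Longrightarrow> matrix_inv A \<in> G"
    and closedin: "closedin (top_of_set {A. invertible A}) G"
begin

text \<open>\<open>G\<close> is closed only relative to the invertible matrices, hence the separate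
  condition on the limit.\<close>

lemma limit_mem:
  assumes "\<And>n. X n \<in> G" "X \<longlonglongrightarrow> L" "invertible L"
  shows "L \<in> G"
proof -
  obtain T where T: "closed T" "G = {A. invertible A} \<inter> T"
    using closedin by (auto simp: closedin_closed)
  then have "L \<in> T"
    using assms closed_sequentially[of T X L] by blast
  with T assms(3) show ?thesis by auto
qed

lemma mat_power_mem: "A \<in> G \<Longrightarrow> mat_power A m \<in> G"
  by (induction m) (auto simp: mat_power_def intro: one_mem mult_mem)

lemma mat_exp_mem: "X \<in> lie_algebra G \<Longrightarrow> mat_exp X \<in> G"
  by (auto simp: lie_algebra_def dest: spec[of _ 1])

lemma lie_algebra_scaleR: "X \<in> lie_algebra G \<Longrightarrow> c *\<^sub>R X \<in> lie_algebra G"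
  by (simp add: lie_algebra_def)

text \<open>The powers of \<open>h n\<close> with exponent the integer part of
  \<open>t / r n\<close> lie in \<open>G\<close> and tend to \<open>exp (t Y)\<close>, which is
  invertible, so closedness applies. Exponents are natural numbers; negative \<open>t\<close> is
  reached by inversion.\<close>

lemma lie_algebra_limit:
  assumes h: "\<And>n. h n \<in> G" and r: "\<And>n. r n > 0" "r \<longlonglongrightarrow> 0"
    and Y: "(\<lambda>n. (h n - mat 1) /\<^sub>R r n) \<longlonglongrightarrow> Y"
  shows "Y \<in> lie_algebra G"
proof -
  have nonneg: "mat_exp (t *\<^sub>R Y) \<in> G" if "t \<ge> 0" for t
  proof (rule limit_mem)
    have "(\<lambda>n. (cmat (h n) - 1) /\<^sub>R r n) \<longlonglongrightarrow> cmat Y"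
      using bounded_linear.tendsto[OF bounded_linear_cmat Y]
      by (simp add: scaleR_cmat.abs_eq[symmetric] minus_cmat.abs_eq[symmetric] cmat_one)
    then have "(\<lambda>n. cmat (h n) ^ nat \<lfloor>t / r n\<rfloor>) \<longlonglongrightarrow> exp (t *\<^sub>R cmat Y)"
      by (intro tendsto_power_exp r that)
    from bounded_linear.tendsto[OF bounded_linear_of_cmat this]
    show "(\<lambda>n. mat_power (h n) (nat \<lfloor>t / r n\<rfloor>)) \<longlonglongrightarrow> mat_exp (t *\<^sub>R Y)"
      by (simp add: of_cmat_power mat_exp_eq scaleR_cmat.abs_eq)
    show "mat_power (h n) (nat \<lfloor>t / r n\<rfloor>) \<in> G" for n
      by (intro mat_power_mem h)
    show "invertible (mat_exp (t *\<^sub>R Y))"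
      using mat_exp_mult_minus[of "t *\<^sub>R Y"] mat_exp_mult_minus[of "- (t *\<^sub>R Y)"]
      by (auto simp: invertible_def)
  qed
  have "mat_exp (t *\<^sub>R Y) \<in> G" for t
  proof (cases "t \<ge> 0")
    case False
    then show ?thesis
      using inv_mem[OF nonneg[of "- t"]] by (simp add: matrix_inv_mat_exp)
  qed (rule nonneg)
  then show ?thesis
    by (simp add: lie_algebra_def)
qed

lemma Ad_mem:
  assumes "k \<in> G" "X \<in> lie_algebra G"
  shows "k ** X ** matrix_inv k \<in> lie_algebra G"
proof -
  have "mat_exp (t *\<^sub>R (k ** X ** matrix_inv k)) = k ** mat_exp (t *\<^sub>R X) ** matrix_inv k" for t
    using mat_exp_conj[of k "t *\<^sub>R X"] invertible[OF assms(1)]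
    by (simp add: matmul.scaleR_left matmul.scaleR_right)
  with assms show ?thesis
    by (auto simp: lie_algebra_def intro: mult_mem inv_mem)
qed

text \<open>Close to the identity, the direction from \<open>1\<close> to a group element is almost tangent to the
  group, so moving back along the corresponding one parameter subgroup halves the distance.\<close>

lemma exp_halves_distance:
  "\<exists>\<delta>>0. \<forall>h\<in>G. 0 < norm (h - mat 1) \<longrightarrow> norm (h - mat 1) < \<delta> \<longrightarrow>
     (\<exists>X\<in>lie_algebra G. norm (mat_exp X ** h - mat 1) \<le> norm (h - mat 1) / 2)"
proof (rule ccontr)
  assume *: "\<not> ?thesis"
  have "\<exists>h\<in>G. 0 < norm (h - mat 1) \<and> norm (h - mat 1) < 1 / Suc n \<and>
      (\<forall>X\<in>lie_algebra G. norm (h - mat 1) / 2 < norm (mat_exp X ** h - mat 1))" for n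
    using * by (auto simp: not_le dest!: spec[of _ "1 / Suc n"])
  then obtain h where h: "\<And>n. h n \<in> G" "\<And>n. 0 < norm (h n - mat 1)"
      "\<And>n. norm (h n - mat 1) < 1 / Suc n"
      "\<And>n X. X \<in> lie_algebra G \<Longrightarrow> norm (h n - mat 1) / 2 < norm (mat_exp X ** h n - mat 1)"
    by metis
  \<comment> \<open>Dividing by \<open>r n\<close> puts the directions into the unit ball; by
    compactness a subsequence has a limit \<open>Y\<close>, a tangent direction of the
    group.\<close>
  define r where "r n = norm (h n - mat 1)" for n
  have r_lim: "r \<longlonglongrightarrow> 0"
  proof (rule Lim_null_comparison)
    show "(\<lambda>n. 1 / real (Suc n)) \<longlonglongrightarrow> 0"
      using LIMSEQ_Suc[OF lim_inverse_n'] by simp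
    show "\<forall>\<^sub>F n in sequentially. norm (r n) \<le> 1 / real (Suc n)"
      using h(3) by (auto simp: r_def less_imp_le)
  qed
  have "\<forall>n. (h n - mat 1) /\<^sub>R r n \<in> cball 0 1"
    using h(2) by (auto simp: r_def)
  then obtain Y \<phi> where \<phi>: "strict_mono \<phi>" and Y: "((\<lambda>n. (h n - mat 1) /\<^sub>R r n) \<circ> \<phi>) \<longlonglongrightarrow> Y"
    by (rule seq_compactE[OF compact_imp_seq_compact[OF compact_cball]])
  have rp: "r (\<phi> n) > 0" for n
    using h(2) by (simp add: r_def)
  have r\<phi>: "(\<lambda>n. r (\<phi> n)) \<longlonglongrightarrow> 0"
    using LIMSEQ_subseq_LIMSEQ[OF r_lim \<phi>] by (simp add: o_def)
  have Y': "(\<lambda>n. (h (\<phi> n) - mat 1) /\<^sub>R r (\<phi> n)) \<longlonglongrightarrow> Y"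
    using Y by (simp add: o_def)
  have Y_mem: "Y \<in> lie_algebra G"
    by (rule lie_algebra_limit[OF _ rp r\<phi> Y']) (rule h(1))
  have "(\<lambda>n. h (\<phi> n) - mat 1) \<longlonglongrightarrow> 0"
    using r\<phi> by (simp add: r_def tendsto_norm_zero_iff)
  then have h_lim: "(\<lambda>n. h (\<phi> n)) \<longlonglongrightarrow> mat 1"
    by (simp add: LIM_zero_iff)
  have "((\<lambda>t. mat_exp (t *\<^sub>R Y)) has_vector_derivative Y ** mat_exp (0 *\<^sub>R Y)) (at 0)"
    by (rule mat_exp_has_vector_derivative_left)
  from has_vector_derivative_quotient_sequentially[OF this, of "\<lambda>n. - r (\<phi> n)"]
  have exp_lim: "(\<lambda>n. (mat_exp (- (r (\<phi> n) *\<^sub>R Y)) - mat 1) /\<^sub>R (- r (\<phi> n))) \<longlonglongrightarrow> Y"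
    using rp r\<phi> tendsto_minus[OF r\<phi>] by (simp add: mat_exp_0 less_imp_neq[symmetric])
  \<comment> \<open>Writing \<open>E h - 1 = (E - 1) h + (h - 1)\<close> with
    \<open>E = exp(-rY)\<close> and dividing by \<open>r\<close>, the summands tend to
    \<open>-Y\<close> and \<open>Y\<close>. Hence \<open>E h - 1\<close> is \<open>o(r)\<close>,
    against the assumption that it exceeds \<open>r / 2\<close>.\<close>
  have "(\<lambda>n. - ((mat_exp (- (r (\<phi> n) *\<^sub>R Y)) - mat 1) /\<^sub>R (- r (\<phi> n))) ** h (\<phi> n)
      + (h (\<phi> n) - mat 1) /\<^sub>R r (\<phi> n)) \<longlonglongrightarrow> - Y ** mat 1 + Y"
    by (intro tendsto_intros matmul.tendsto exp_lim h_lim Y')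
  moreover have "- ((E - mat 1) /\<^sub>R (- s)) ** h' + (h' - mat 1) /\<^sub>R s = (E ** h' - mat 1) /\<^sub>R s"
    for E h' :: "complex^'n^'n" and s :: real
    by (simp add: matmul.scaleR_left matmul.diff_left scaleR_diff_right)
  ultimately have "(\<lambda>n. (mat_exp (- (r (\<phi> n) *\<^sub>R Y)) ** h (\<phi> n) - mat 1) /\<^sub>R r (\<phi> n)) \<longlonglongrightarrow> 0"
    by (simp add: matmul.minus_left)
  then have "(\<lambda>n. norm ((mat_exp (- (r (\<phi> n) *\<^sub>R Y)) ** h (\<phi> n) - mat 1) /\<^sub>R r (\<phi> n))) \<longlonglongrightarrow> 0"
    by (rule tendsto_norm_zero)
  then have "\<forall>\<^sub>F n in sequentially.
      norm ((mat_exp (- (r (\<phi> n) *\<^sub>R Y)) ** h (\<phi> n) - mat 1) /\<^sub>R r (\<phi> n)) < 1 / 2"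
    by (rule order_tendstoD) simp
  then obtain n where
    "norm ((mat_exp (- (r (\<phi> n) *\<^sub>R Y)) ** h (\<phi> n) - mat 1) /\<^sub>R r (\<phi> n)) < 1 / 2"
    by (auto simp: eventually_sequentially)
  then have "norm (mat_exp (- (r (\<phi> n) *\<^sub>R Y)) ** h (\<phi> n) - mat 1) < r (\<phi> n) / 2"
    using rp[of n] by (simp add: divide_inverse[symmetric] mult.commute[of "inverse _"] pos_divide_less_eq)
  moreover have "- (r (\<phi> n) *\<^sub>R Y) \<in> lie_algebra G"
    using lie_algebra_scaleR[OF Y_mem, of "- r (\<phi> n)"] by simp
  ultimately show False
    using h(4)[of "- (r (\<phi> n) *\<^sub>R Y)" "\<phi> n"] by (simp add: r_def)
qed

text \<open>For \<open>g\<close> near the identity the distances \<open>norm (e ** g - mat 1)\<close> with \<open>e \<in> H\<close> have infimum \<open>0\<close>,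
  because a positive one could be halved; closedness of \<open>H\<close> then gives \<open>g \<in> H\<close>.\<close>

lemma connected_eq_subgroup:
  assumes "connected G" "H \<subseteq> G" "mat 1 \<in> H"
    and mult: "\<And>x y. x \<in> H \<Longrightarrow> y \<in> H \<Longrightarrow> x ** y \<in> H"
    and inv: "\<And>x. x \<in> H \<Longrightarrow> matrix_inv x \<in> H"
    and lim: "\<And>X L. (\<And>n. X n \<in> H) \<Longrightarrow> X \<longlonglongrightarrow> L \<Longrightarrow> L \<in> G \<Longrightarrow> L \<in> H"
    and exp: "\<And>X. X \<in> lie_algebra G \<Longrightarrow> mat_exp X \<in> H"
  shows "H = G"
proof -
  obtain \<delta> where \<delta>: "\<delta> > 0" and halve: "\<And>h. h \<in> G \<Longrightarrow> 0 < norm (h - mat 1) \<Longrightarrow>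
      norm (h - mat 1) < \<delta> \<Longrightarrow>
      \<exists>X\<in>lie_algebra G. norm (mat_exp X ** h - mat 1) \<le> norm (h - mat 1) / 2"
    using exp_halves_distance by blast
  have near: "g \<in> H" if g: "g \<in> G" "norm (g - mat 1) < \<delta>" for g
  proof -
    define S where "S = (\<lambda>e. norm (e ** g - mat 1)) ` H"
    define I where "I = Inf S"
    have bdd: "bdd_below S"
      by (auto simp: S_def intro: bdd_belowI[of _ 0])
    have S_ne: "S \<noteq> {}"
      using assms(3) by (auto simp: S_def)
    have "norm (g - mat 1) \<in> S"
      using assms(3) by (auto simp: S_def intro!: image_eqI[of _ _ "mat 1"])
    then have I_less: "I < \<delta>"
      using g(2) cInf_lower[OF _ bdd] unfolding I_def by fastforce
    have "I \<ge> 0"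
      unfolding I_def using S_ne by (intro cInf_greatest) (auto simp: S_def)
    moreover have "\<not> I > 0"
    proof
      assume "I > 0"
      \<comment> \<open>Any factor strictly between 1 and 2 would do: halving a distance below
        \<open>3/2 * I\<close> leaves less than \<open>I\<close>. The bound \<open>\<delta>\<close>
        keeps \<open>e ** g\<close> within the range of \<open>halve\<close>.\<close>
      then have "Inf S < min \<delta> (3 / 2 * I)"
        using I_less by (simp add: I_def)
      then obtain e where e: "e \<in> H" "norm (e ** g - mat 1) < min \<delta> (3 / 2 * I)"
        using cInf_lessD[OF S_ne, of "min \<delta> (3 / 2 * I)"] unfolding S_def by blast
      have "norm (e ** g - mat 1) \<in> S"
        using e(1) by (auto simp: S_def)
      then have "norm (e ** g - mat 1) > 0"
        using cInf_lower[OF _ bdd] \<open>I > 0\<close> unfolding I_def by fastforce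
      moreover have "e ** g \<in> G"
        using e(1) assms(2) g(1) by (auto intro: mult_mem)
      ultimately obtain X where X: "X \<in> lie_algebra G"
          "norm (mat_exp X ** (e ** g) - mat 1) \<le> norm (e ** g - mat 1) / 2"
        using halve[of "e ** g"] e(2) by auto
      have "norm (mat_exp X ** e ** g - mat 1) \<in> S"
        using e(1) exp[OF X(1)] by (auto simp: S_def intro: mult)
      then have "I \<le> norm (mat_exp X ** e ** g - mat 1)"
        unfolding I_def by (rule cInf_lower[OF _ bdd])
      with X(2) e(2) \<open>I > 0\<close> show False
        by (simp add: matrix_mul_assoc)
    qed
    ultimately have I0: "Inf S = 0"
      by (simp add: I_def)
    have "\<exists>e\<in>H. norm (e ** g - mat 1) < 1 / Suc n" for n
      using cInf_lessD[OF S_ne, of "1 / Suc n"] I0 by (auto simp: S_def)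
    then obtain e where e: "\<And>n. e n \<in> H" "\<And>n. norm (e n ** g - mat 1) < 1 / Suc n"
      by metis
    have "(\<lambda>n. e n ** g - mat 1) \<longlonglongrightarrow> 0"
    proof (rule Lim_null_comparison)
      show "(\<lambda>n. 1 / real (Suc n)) \<longlonglongrightarrow> 0"
        using LIMSEQ_Suc[OF lim_inverse_n'] by simp
      show "\<forall>\<^sub>F n in sequentially. norm (e n ** g - mat 1) \<le> 1 / real (Suc n)"
        using e(2) by (auto simp: less_imp_le)
    qed
    then have "(\<lambda>n. e n ** g) \<longlonglongrightarrow> mat 1"
      by (simp add: LIM_zero_iff)
    then have "(\<lambda>n. e n ** g ** matrix_inv g) \<longlonglongrightarrow> mat 1 ** matrix_inv g"
      by (intro matmul.tendsto tendsto_const)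
    then have "e \<longlonglongrightarrow> matrix_inv g"
      using invertible[OF g(1)] by (simp add: matrix_mul_assoc[symmetric] matrix_inv)
    then have "matrix_inv g \<in> H"
      by (rule lim[OF e(1) _ inv_mem[OF g(1)]])
    then show "g \<in> H"
      using inv[of "matrix_inv g"] invertible[OF g(1)] by (simp add: matrix_inv_matrix_inv)
  qed
  have "g \<in> H" if "g \<in> G" for g
  proof -
    \<comment> \<open>The relation says that \<open>x\<close> and \<open>y\<close> lie in the same
      left coset of \<open>H\<close>. By \<open>near\<close> the cosets are open in
      \<open>G\<close>, so connectedness leaves only one.\<close>
    have "matrix_inv (mat 1) ** g \<in> H"
    proof (rule connected_equivalence_relation[OF assms(1) one_mem that,
          where R = "\<lambda>x y. matrix_inv x ** y \<in> H"])
      fix x y assume xy: "matrix_inv x ** y \<in> H" "x \<in> G" "y \<in> G"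
      have "matrix_inv (matrix_inv x ** y) = matrix_inv y ** x"
        using xy(2,3) by (simp add: matrix_inv_mult invertible invertible_matrix_inv matrix_inv_matrix_inv)
      then show "matrix_inv y ** x \<in> H"
        using inv[OF xy(1)] by simp
    next
      fix x y z assume *: "matrix_inv x ** y \<in> H" "matrix_inv y ** z \<in> H" "y \<in> G"
      have "matrix_inv x ** y ** (matrix_inv y ** z) = matrix_inv x ** (y ** matrix_inv y) ** z"
        by (simp add: matrix_mul_assoc)
      also have "\<dots> = matrix_inv x ** z"
        using invertible[OF *(3)] by (simp add: matrix_inv)
      finally show "matrix_inv x ** z \<in> H"
        using mult[OF *(1,2)] by simp
    next
      fix x assume x: "x \<in> G"
      let ?T = "G \<inter> (\<lambda>y. matrix_inv x ** y) -` ball (mat 1) \<delta>"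
      have "openin (top_of_set G) ?T"
        by (intro continuous_openin_preimage_gen) (auto intro!: matmul.continuous_on continuous_intros)
      moreover have "x \<in> ?T"
        using x \<delta> invertible[OF x] by (simp add: matrix_inv)
      moreover have "\<forall>y\<in>?T. matrix_inv x ** y \<in> H"
        using x by (auto intro!: near mult_mem inv_mem simp: dist_norm norm_minus_commute)
      ultimately show "\<exists>T. openin (top_of_set G) T \<and> x \<in> T \<and> (\<forall>y\<in>T. matrix_inv x ** y \<in> H)"
        by blast
    qed
    moreover have "matrix_inv (mat 1 :: complex^'n^'n) = mat 1"
      by (rule matrix_inv_unique) simp_all
    ultimately show ?thesis by simp
  qed
  with assms(2) show ?thesis by blast
qed

end

section \<open>From infinitesimal invariance of the form to invariance under
  \<open>Ad\<close>\<close>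

lemma cscale_of_real: "cscale (of_real c) A = c *\<^sub>R A"
  by (simp add: cscale_def vec_eq_iff scaleR_conv_of_real[where 'a=complex])

lemma csubspace_imp_subspace: "csubspace S \<Longrightarrow> subspace S"
  unfolding csubspace_def subspace_def by (metis cscale_of_real)

lemma invariant_form_scaleR:
  assumes "invariant_form g B" "x \<in> g" "y \<in> g"
  shows "B (c *\<^sub>R x) y = c *\<^sub>R B x y"
  using assms unfolding invariant_form_def by (metis cscale_of_real scaleR_conv_of_real)

text \<open>Precomposing both arguments with a linear projection onto \<open>g\<close> gives a
  bilinear map on all matrices, to which the product rule and limit theorems apply.\<close>

lemma invariant_form_extension:
  fixes g :: "(complex^'n^'n) set"
  assumes "subspace g" "invariant_form g B"
  obtains B' where "bounded_bilinear B'" "\<And>x y. x \<in> g \<Longrightarrow> y \<in> g \<Longrightarrow> B' x y = B x y"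
proof -
  obtain P :: "complex^'n^'n \<Rightarrow> complex^'n^'n"
    where P: "range P \<subseteq> g" "linear P" "\<And>x. x \<in> g \<Longrightarrow> P x = x"
    using linear_exists_left_inverse_on[OF linear_ident assms(1)] by auto
  then have Pg: "P x \<in> g" for x by blast
  have B: "B (x + y) z = B x z + B y z" "B (c *\<^sub>R x) z = c *\<^sub>R B x z"
    if "x \<in> g" "y \<in> g" "z \<in> g" for x y z c
    using assms(2) that invariant_form_scaleR[OF assms(2)] by (auto simp: invariant_form_def)
  have sym: "B x y = B y x" if "x \<in> g" "y \<in> g" for x y
    using assms(2) that by (auto simp: invariant_form_def)
  have "bilinear (\<lambda>x y. B (P x) (P y))"
    unfolding bilinear_def
  proof (intro conjI allI linearI)
    fix x y z c
    show "B (P x) (P (y + z)) = B (P x) (P y) + B (P x) (P z)"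
      using B(1)[of "P y" "P z" "P x"] sym Pg subspace_add[OF assms(1)]
      by (simp add: linear_add[OF P(2)])
    show "B (P x) (P (c *\<^sub>R y)) = c *\<^sub>R B (P x) (P y)"
      using B(2)[of "P y" "P y" "P x" c] sym Pg subspace_scale[OF assms(1)]
      by (simp add: linear_scale[OF P(2)])
    show "B (P (x + y)) (P z) = B (P x) (P z) + B (P y) (P z)"
      using B(1) Pg by (simp add: linear_add[OF P(2)])
    show "B (P (c *\<^sub>R x)) (P y) = c *\<^sub>R B (P x) (P y)"
      using B(2)[of "P x" "P x" "P y" c] Pg by (simp add: linear_scale[OF P(2)])
  qed
  then have "bounded_bilinear (\<lambda>x y. B (P x) (P y))"
    by (simp only: bilinear_conv_bounded_bilinear)
  then show ?thesis
    using P(3) by (intro that[of "\<lambda>x y. B (P x) (P y)"]) auto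
qed

context closed_matrix_group
begin

text \<open>The bracket is the velocity at 0 of \<open>exp(tX) Y exp(-tX)\<close>, a curve in the
  Lie algebra, and a finite dimensional subspace is closed.\<close>

lemma lie_bracket_mem:
  assumes "subspace (lie_algebra G)" "X \<in> lie_algebra G" "Y \<in> lie_algebra G"
  shows "lie_bracket X Y \<in> lie_algebra G"
proof (rule derivative_in_closed_subspace)
  show "((\<lambda>t. mat_exp (t *\<^sub>R X) ** Y ** mat_exp (t *\<^sub>R - X)) has_vector_derivative
      lie_bracket X Y) (at 0)"
    by (rule has_vector_derivative_eq_rhs,
        rule matmul.has_vector_derivative[OF matmul.has_vector_derivative[OF
          mat_exp_has_vector_derivative_left has_vector_derivative_const]
        mat_exp_has_vector_derivative_left])
      (simp add: mat_exp_0 lie_bracket_def matmul.minus_right matmul.minus_left matmul.zero_right)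
  show "mat_exp (t *\<^sub>R X) ** Y ** mat_exp (t *\<^sub>R - X) \<in> lie_algebra G" for t
    using Ad_mem[of "mat_exp (t *\<^sub>R X)" Y] assms
    by (simp add: matrix_inv_mat_exp mat_exp_mem lie_algebra_scaleR)
qed (use assms(1) closed_subspace in auto)

lemma Ad_mult:
  assumes "k \<in> G" "l \<in> G"
  shows "k ** l ** X ** matrix_inv (k ** l) = k ** (l ** X ** matrix_inv l) ** matrix_inv k"
  using assms by (simp add: matrix_inv_mult invertible matrix_mul_assoc)

text \<open>Along \<open>c z t = exp(tX) z exp(-tX)\<close> the derivative of the form is
  \<open>B([X, c x], c y) + B(c x, [X, c y])\<close>, which vanishes by infinitesimal invariance;
  compare \<open>t = 1\<close> with \<open>t = 0\<close>.\<close>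

lemma invariant_form_exp:
  assumes sub: "subspace (lie_algebra G)" and inv: "invariant_form (lie_algebra G) B"
    and "X \<in> lie_algebra G" "x \<in> lie_algebra G" "y \<in> lie_algebra G"
  shows "B (mat_exp X ** x ** mat_exp (- X)) (mat_exp X ** y ** mat_exp (- X)) = B x y"
proof -
  obtain B' where B': "bounded_bilinear B'"
      "\<And>x y. x \<in> lie_algebra G \<Longrightarrow> y \<in> lie_algebra G \<Longrightarrow> B' x y = B x y"
    using invariant_form_extension[OF sub inv] by blast
  interpret B': bounded_bilinear B' by (rule B'(1))
  define c where "c z t = mat_exp (t *\<^sub>R X) ** z ** mat_exp (t *\<^sub>R - X)" for z t
  have c_mem: "c z t \<in> lie_algebra G" if "z \<in> lie_algebra G" for z t
    using Ad_mem[of "mat_exp (t *\<^sub>R X)" z] that assms(3)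
    by (simp add: matrix_inv_mat_exp mat_exp_mem lie_algebra_scaleR c_def)
  have c_deriv: "(c z has_vector_derivative lie_bracket X (c z t)) (at t)" for z t
    unfolding c_def
    by (rule has_vector_derivative_eq_rhs,
        rule matmul.has_vector_derivative[OF matmul.has_vector_derivative[OF
          mat_exp_has_vector_derivative_left has_vector_derivative_const]
        mat_exp_has_vector_derivative_right])
      (simp add: lie_bracket_def matmul.minus_right matmul.zero_right matrix_mul_assoc)
  have inv0: "B (lie_bracket X u) v + B u (lie_bracket X v) = 0"
    if "u \<in> lie_algebra G" "v \<in> lie_algebra G" for u v
    using inv assms(3) that unfolding invariant_form_def by blast
  have deriv: "((\<lambda>t. B' (c x t) (c y t)) has_vector_derivative 0) (at t)" for t
  proof -
    have "((\<lambda>t. B' (c x t) (c y t)) has_vector_derivative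
        B' (c x t) (lie_bracket X (c y t)) + B' (lie_bracket X (c x t)) (c y t)) (at t)"
      by (intro B'.has_vector_derivative c_deriv)
    also have "B' (c x t) (lie_bracket X (c y t)) + B' (lie_bracket X (c x t)) (c y t) = 0"
      using inv0[OF c_mem c_mem, of x y t t] c_mem lie_bracket_mem[OF sub assms(3)] assms(4,5)
      by (simp add: B'(2) add.commute)
    finally show ?thesis .
  qed
  obtain d where "\<And>t. t \<in> UNIV \<Longrightarrow> B' (c x t) (c y t) = d"
    by (rule has_vector_derivative_zero_constant[OF convex_UNIV
          has_vector_derivative_at_within[OF deriv]]) blast
  then have "B' (c x 1) (c y 1) = B' (c x 0) (c y 0)"
    by simp
  moreover have "c z 0 = z" for z
    by (simp add: c_def mat_exp_0)
  moreover have "c z 1 = mat_exp X ** z ** mat_exp (- X)" for z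
    by (simp add: c_def)
  ultimately show ?thesis
    using c_mem[OF assms(4), of 1] c_mem[OF assms(5), of 1] assms(4,5) by (simp add: B'(2))
qed

text \<open>The elements preserving the form are a subgroup \<open>H\<close>. It is closed in
  \<open>G\<close> because the bilinear extension and the inverse are continuous, and it contains
  the exponentials, so \<open>connected_eq_subgroup\<close> applies.\<close>

lemma invariant_form_Ad:
  assumes "connected G" and sub: "subspace (lie_algebra G)"
    and inv: "invariant_form (lie_algebra G) B"
    and "k \<in> G" "x \<in> lie_algebra G" "y \<in> lie_algebra G"
  shows "B (k ** x ** matrix_inv k) (k ** y ** matrix_inv k) = B x y"
proof -
  define H where "H = {k \<in> G. \<forall>x\<in>lie_algebra G. \<forall>y\<in>lie_algebra G.
      B (k ** x ** matrix_inv k) (k ** y ** matrix_inv k) = B x y}"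
  obtain B' where B': "bounded_bilinear B'"
      "\<And>x y. x \<in> lie_algebra G \<Longrightarrow> y \<in> lie_algebra G \<Longrightarrow> B' x y = B x y"
    using invariant_form_extension[OF sub inv] by blast
  interpret B': bounded_bilinear B' by (rule B'(1))
  have "H = G"
  proof (rule connected_eq_subgroup)
    show "connected G" "H \<subseteq> G"
      using assms(1) by (auto simp: H_def)
    have "matrix_inv (mat 1 :: complex^'n^'n) = mat 1"
      by (rule matrix_inv_unique) simp_all
    then show "mat 1 \<in> H"
      by (simp add: H_def one_mem)
    show "k ** l \<in> H" if "k \<in> H" "l \<in> H" for k l
      using that Ad_mem by (auto simp: H_def mult_mem Ad_mult)
    show "matrix_inv k \<in> H" if "k \<in> H" for k
    proof -
      have k: "k \<in> G" using that by (simp add: H_def)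
      \<comment> \<open>\<open>Ad k\<close> undoes \<open>Ad\<close> of the inverse, so invariance
        under \<open>k\<close>, applied to vectors already moved by the inverse, is invariance under
        the inverse.\<close>
      have "k ** (matrix_inv k ** z ** matrix_inv (matrix_inv k)) ** matrix_inv k = z" for z
        using k Ad_mult[OF k inv_mem[OF k], of z] \<open>matrix_inv (mat 1) = mat 1\<close>
        by (simp add: matrix_inv invertible)
      moreover have "matrix_inv k ** z ** matrix_inv (matrix_inv k) \<in> lie_algebra G"
        if "z \<in> lie_algebra G" for z
        using Ad_mem[OF inv_mem[OF k] that] .
      ultimately show ?thesis
        using \<open>k \<in> H\<close> inv_mem[OF k] by (auto simp: H_def) metis
    qed
    show "L \<in> H" if "\<And>n. X n \<in> H" "X \<longlonglongrightarrow> L" "L \<in> G" for X L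
    proof -
      have XG: "X n \<in> G" for n using that(1) by (simp add: H_def)
      have Ad_lim: "(\<lambda>n. X n ** z ** matrix_inv (X n)) \<longlonglongrightarrow> L ** z ** matrix_inv L" for z
        using XG \<open>L \<in> G\<close> by (intro matmul.tendsto tendsto_matrix_inv that tendsto_const
            always_eventually allI invertible)
      have "B (L ** x ** matrix_inv L) (L ** y ** matrix_inv L) = B x y"
        if xy: "x \<in> lie_algebra G" "y \<in> lie_algebra G" for x y
      proof -
        have "(\<lambda>n. B' (X n ** x ** matrix_inv (X n)) (X n ** y ** matrix_inv (X n))) \<longlonglongrightarrow>
            B' (L ** x ** matrix_inv L) (L ** y ** matrix_inv L)"
          by (intro B'.tendsto Ad_lim)
        moreover have "B' (X n ** x ** matrix_inv (X n)) (X n ** y ** matrix_inv (X n)) = B x y" for n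
          using \<open>\<And>n. X n \<in> H\<close>[of n] xy Ad_mem[OF XG] by (simp add: H_def B'(2))
        ultimately show ?thesis
          using xy Ad_mem[OF \<open>L \<in> G\<close>] by (simp add: B'(2) LIMSEQ_const_iff)
      qed
      with that(3) show ?thesis by (simp add: H_def)
    qed
    show "mat_exp X \<in> H" if "X \<in> lie_algebra G" for X
      using that by (simp add: H_def mat_exp_mem matrix_inv_mat_exp invariant_form_exp[OF sub inv])
  qed
  with assms show ?thesis
    by (auto simp: H_def)
qed

end

section \<open>Holomorphic functions inside and outside the unit circle\<close>

text \<open>Cauchy's formula at the centre; the velocity of the circle cancels the kernel
  \<open>1 / u\<close> up to \<open>\<i>\<close>.\<close>

lemma mean_value_circle:
  fixes f :: "complex \<Rightarrow> complex"
  assumes "continuous_on (cball 0 1) f" "f holomorphic_on ball 0 1"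
  shows "integral {0..2 * pi} (\<lambda>\<theta>. f (cis \<theta>)) = 2 * pi * f 0"
proof -
  have "contour_integral (circlepath 0 1) (\<lambda>u. f u / (u - 0)) = 2 * pi * \<i> * f 0"
    by (rule contour_integral_unique)
      (use Cauchy_integral_circlepath[OF assms, of 0] in simp)
  moreover have "contour_integral (circlepath 0 1) (\<lambda>u. f u / (u - 0)) =
      integral {0..2 * pi} (\<lambda>t. f (cis t) / cis t * \<i> * cis t)"
    by (simp add: circlepath_def contour_integral_part_circlepath_eq)
  moreover have "(\<lambda>t. f (cis t) / cis t * \<i> * cis t) = (\<lambda>t. \<i> * f (cis t))"
    by auto
  ultimately show ?thesis
    by (simp add: integral_mult_right mult.assoc)
qed

text \<open>Schwarz reflection across the unit circle.\<close>

lemma reflect_outside: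
  assumes cont: "continuous_on {z. 1 \<le> norm z} F" and hol: "F holomorphic_on {z. 1 < norm z}"
    and lim: "(F \<longlongrightarrow> L) at_infinity"
  obtains R where "continuous_on (cball 0 1) R" "R holomorphic_on ball 0 1"
    "R 0 = cnj L" "\<And>\<theta>. R (cis \<theta>) = cnj (F (cis \<theta>))"
proof -
  \<comment> \<open>The map \<open>inverse (cnj z)\<close> fixes the circle and takes the punctured
    disc to the exterior, with 0 corresponding to infinity; hence the value \<open>cnj L\<close> at
    0.\<close>
  define R where "R z = (if z = 0 then cnj L else cnj (F (inverse (cnj z))))" for z
  have away: "continuous_on (cball 0 1 - {0}) R"
  proof -
    have "continuous_on (cball 0 1 - {0}) (\<lambda>z. cnj (F (inverse (cnj z))))"
      by (intro continuous_intros continuous_on_compose2[OF cont])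
        (auto simp: norm_inverse one_le_inverse_iff)
    then show ?thesis
      by (rule continuous_on_eq) (simp add: R_def)
  qed
  have R_lim: "(R \<longlongrightarrow> R 0) (at 0)"
  proof -
    have "filterlim (\<lambda>z. inverse (cnj z)) at_infinity (at 0)"
      by (intro filterlim_compose[OF filterlim_inverse_at_infinity])
        (auto simp: filterlim_at eventually_at_filter intro!: tendsto_eq_intros)
    then have "((\<lambda>z. cnj (F (inverse (cnj z)))) \<longlongrightarrow> cnj L) (at 0)"
      by (intro tendsto_cnj filterlim_compose[OF lim])
    then have "((\<lambda>z. cnj (F (inverse (cnj z)))) \<longlongrightarrow> R 0) (at 0)"
      by (simp add: R_def)
    then show ?thesis
      by (rule Lim_transform_eventually) (simp add: R_def eventually_at_filter)
  qed
  have R_cont: "continuous_on (cball 0 1) R"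
    unfolding continuous_on_def
  proof
    fix z :: complex assume z: "z \<in> cball 0 1"
    show "(R \<longlongrightarrow> R z) (at z within cball 0 1)"
    proof (cases "z = 0")
      case True
      with R_lim show ?thesis
        by (auto intro: tendsto_within_subset)
    next
      case False
      then have "(R \<longlongrightarrow> R z) (at z within cball 0 1 - {0})"
        using away z by (auto simp: continuous_on_def)
      moreover have "at z within cball 0 1 - {0} = at z within cball 0 1"
        using False by (intro at_within_nhd[of _ "- {0}"]) auto
      ultimately show ?thesis by simp
    qed
  qed
  \<comment> \<open>Conjugating both the argument and the value preserves holomorphy, so it is
    enough to treat \<open>F (inverse z)\<close> on the conjugated domain.\<close>
  have "(\<lambda>z. F (inverse z)) holomorphic_on cnj ` (ball 0 1 - {0})"
    by (intro holomorphic_intros holomorphic_on_compose_gen[OF _ hol, unfolded o_def])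
      (auto simp: norm_inverse one_less_inverse_iff)
  then have "cnj \<circ> (\<lambda>z. F (inverse z)) \<circ> cnj holomorphic_on (ball 0 1 - {0})"
    by (rule holomorphic_on_compose_cnj_cnj) auto
  then have "R holomorphic_on (ball 0 1 - {0})"
    by (rule holomorphic_transform) (auto simp: R_def)
  then have "R holomorphic_on ball 0 1"
    by (rule no_isolated_singularity[OF continuous_on_subset[OF R_cont ball_subset_cball] _ open_ball])
      simp
  moreover have "R (cis \<theta>) = cnj (F (cis \<theta>))" for \<theta>
  proof -
    have "inverse (cnj (cis \<theta>)) = cis \<theta>"
      by (simp only: cis_cnj cis_inverse minus_minus)
    then show ?thesis
      by (simp only: R_def cis_neq_zero if_False)
  qed
  ultimately show ?thesis
    using R_cont by (intro that[of R]) (auto simp: R_def)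
qed

text \<open>For \<open>p = P - L\<close> the product of \<open>p\<close> with the reflection of \<open>F - L\<close> is holomorphic inside,
  vanishes at \<open>0\<close> and equals \<open>\<bar>p\<bar>\<^sup>2\<close> on the circle.\<close>

lemma inside_outside_constant:
  assumes P: "continuous_on (cball 0 1) P" "P holomorphic_on ball 0 1"
    and F: "continuous_on {z. 1 \<le> norm z} F" "F holomorphic_on {z. 1 < norm z}"
      "(F \<longlongrightarrow> L) at_infinity"
    and eq: "\<And>\<theta>. P (cis \<theta>) = F (cis \<theta>)"
  shows "P (cis \<theta>) = L"
proof -
  obtain R where R: "continuous_on (cball 0 1) R" "R holomorphic_on ball 0 1"
      "R 0 = cnj L" "\<And>\<theta>. R (cis \<theta>) = cnj (F (cis \<theta>))"
    using reflect_outside[OF F] by blast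
  define q where "q \<theta> = (norm (P (cis \<theta>) - L))\<^sup>2" for \<theta>
  have q_cont: "continuous_on A q" for A
    unfolding q_def
    by (intro continuous_intros continuous_on_compose2[OF P(1)]) auto
  have "integral {0..2 * pi} (\<lambda>\<theta>. (P (cis \<theta>) - L) * (R (cis \<theta>) - cnj L)) =
      2 * pi * ((P 0 - L) * (R 0 - cnj L))"
    by (rule mean_value_circle[of "\<lambda>z. (P z - L) * (R z - cnj L)"])
      (intro continuous_intros holomorphic_intros P R)+
  moreover have "(P (cis \<theta>) - L) * (R (cis \<theta>) - cnj L) = of_real (q \<theta>)" for \<theta>
    unfolding R(4) eq[symmetric] q_def
    by (simp add: complex_norm_square[symmetric] del: complex_cnj_diff flip: complex_cnj_diff)
  ultimately have "integral {0..2 * pi} (\<lambda>\<theta>. complex_of_real (q \<theta>)) = 0"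
    by (simp add: R(3))
  then have "integral {0..2 * pi} q = 0"
    using integral_linear[OF integrable_continuous_interval[OF q_cont]
        bounded_linear_of_real[where 'a=complex]]
    by (simp add: o_def)
  then have zero: "\<forall>\<theta>\<in>{0..2 * pi}. q \<theta> = 0"
    by (rule integral_eq_0_iff[THEN iffD1, OF q_cont, rotated 2]) (simp_all add: q_def)
  \<comment> \<open>The integral controls \<open>q\<close> only on one period; \<open>Arg2pi\<close>
    moves an arbitrary angle into it without changing the point of the circle.\<close>
  have "Arg2pi (cis \<theta>) \<in> {0..2 * pi}"
    by (simp add: Arg2pi_ge_0 Arg2pi_lt_2pi less_imp_le)
  then have "q (Arg2pi (cis \<theta>)) = 0"
    by (rule bspec[OF zero])
  moreover have "cis (Arg2pi (cis \<theta>)) = cis \<theta>"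
    using Arg2pi_eq[of "cis \<theta>", symmetric] by (simp add: cis_conv_exp)
  ultimately show ?thesis
    by (simp add: q_def)
qed

text \<open>After reflection the integral is the conjugate of the mean of
  \<open>z ^ m * R z\<close>, whose value at 0 is zero as \<open>m > 0\<close>. So boundary values
  of functions holomorphic up to infinity have no positive Fourier coefficients.\<close>

lemma outside_positive_coeff:
  assumes F: "continuous_on {z. 1 \<le> norm z} F" "F holomorphic_on {z. 1 < norm z}"
      "(F \<longlongrightarrow> L) at_infinity" and "m > 0"
  shows "integral {0..2 * pi} (\<lambda>\<theta>. cis (- (real m * \<theta>)) * F (cis \<theta>)) = 0"
proof -
  obtain R where R: "continuous_on (cball 0 1) R" "R holomorphic_on ball 0 1"
      "\<And>\<theta>. R (cis \<theta>) = cnj (F (cis \<theta>))"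
    using reflect_outside[OF F] by blast
  have "integral {0..2 * pi} (\<lambda>\<theta>. cis \<theta> ^ m * R (cis \<theta>)) = 2 * pi * (0 ^ m * R 0)"
    by (rule mean_value_circle[of "\<lambda>z. z ^ m * R z"]) (intro continuous_intros holomorphic_intros R)+
  then have "integral {0..2 * pi} (\<lambda>\<theta>. cnj (cis (- (real m * \<theta>)) * F (cis \<theta>))) = 0"
    using \<open>m > 0\<close> by (simp add: R(3) cis_cnj Complex.DeMoivre)
  then show ?thesis
    by (simp add: Henstock_Kurzweil_Integration.integral_cnj[symmetric] del: complex_cnj_mult)
qed

section \<open>Conjugation of loops\<close>

lemma Ck_bounded_linear:
  assumes "bounded_linear h"
  shows "Ck m f \<Longrightarrow> Ck m (\<lambda>x. h (f x))"
proof (induction m arbitrary: f)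
  case 0
  then show ?case
    by (auto intro: bounded_linear.continuous_on[OF assms])
next
  case (Suc m)
  have deriv: "((\<lambda>x. h (f x)) has_derivative (\<lambda>v. h (frechet_derivative f (at x) v))) (at x)" for x
    using Suc.prems by (intro bounded_linear.has_derivative[OF assms])
      (simp add: frechet_derivative_works[symmetric])
  have "frechet_derivative (\<lambda>x. h (f x)) (at x) v = h (frechet_derivative f (at x) v)" for x v
    using fun_cong[OF frechet_derivative_at[OF deriv], of x v] by (rule sym)
  with Suc deriv show ?case
    by (auto simp: differentiable_def)
qed

lemma smooth_bounded_linear: "bounded_linear h \<Longrightarrow> smooth f \<Longrightarrow> smooth (\<lambda>x. h (f x))"
  by (simp add: smooth_def Ck_bounded_linear)

lemma smooth_conj: "smooth f \<Longrightarrow> smooth (\<lambda>x. (k :: complex^'n^'n) ** f x ** (l :: complex^'n^'n))"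
  by (rule smooth_bounded_linear[OF bounded_linear_conj])

lemma smooth_has_derivative:
  "smooth f \<Longrightarrow> (f has_derivative frechet_derivative f (at x)) (at x)"
  unfolding smooth_def by (metis Ck.simps(2) frechet_derivative_works)

lemma smooth_frechet_derivative:
  "smooth f \<Longrightarrow> smooth (\<lambda>x. frechet_derivative f (at x) v)"
  unfolding smooth_def by (metis Ck.simps(2))

section \<open>Entrywise holomorphy of matrix operations\<close>

lemma holomorphic_matrix_mult:
  fixes F :: "complex \<Rightarrow> complex^'n^'m" and H :: "complex \<Rightarrow> complex^'p^'n"
  assumes "\<And>i j. (\<lambda>z. F z $ i $ j) holomorphic_on S" "\<And>i j. (\<lambda>z. H z $ i $ j) holomorphic_on S"
  shows "(\<lambda>z. (F z ** H z) $ i $ j) holomorphic_on S"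
  unfolding matrix_matrix_mult_def by (simp, intro holomorphic_intros assms)

lemma holomorphic_det:
  fixes F :: "complex \<Rightarrow> complex^'n^'n"
  assumes "\<And>i j. (\<lambda>z. F z $ i $ j) holomorphic_on S"
  shows "(\<lambda>z. det (F z)) holomorphic_on S"
  unfolding det_def by (intro holomorphic_intros assms)

lemma holomorphic_matrix_inv:
  fixes F :: "complex \<Rightarrow> complex^'n^'n"
  assumes F: "\<And>i j. (\<lambda>z. F z $ i $ j) holomorphic_on S" and inv: "\<And>z. z \<in> S \<Longrightarrow> invertible (F z)"
  shows "(\<lambda>z. matrix_inv (F z) $ k $ l) holomorphic_on S"
proof (rule holomorphic_transform)
  show "(\<lambda>z. det (\<chi> i j. if j = k then axis l 1 $ i else F z $ i $ j) / det (F z)) holomorphic_on S"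
  proof (intro holomorphic_intros holomorphic_det F)
    show "(\<lambda>z. (\<chi> i j. if j = k then axis l 1 $ i else F z $ i $ j) $ i $ j) holomorphic_on S" for i j
      by (cases "j = k") (auto intro: F)
    show "det (F z) \<noteq> 0" if "z \<in> S" for z
      using inv[OF that] by (simp add: invertible_det_nz)
  qed
  show "det (\<chi> i j. if j = k then axis l 1 $ i else F z $ i $ j) / det (F z) = matrix_inv (F z) $ k $ l"
    if "z \<in> S" for z
    using matrix_inv_nth[OF inv[OF that]] by simp
qed

section \<open>Conjugation as an automorphism of the loop groups\<close>

lemma loop_conj_mult:
  assumes "invertible k"
  shows "loop_conj k (loop_mult f g) = loop_mult (loop_conj k f) (loop_conj k g)"
proof -
  have "k ** A ** matrix_inv k ** (k ** C ** matrix_inv k)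
      = k ** A ** (matrix_inv k ** k) ** C ** matrix_inv k" for A C
    by (simp add: matrix_mul_assoc)
  then show ?thesis
    by (simp add: loop_conj_def loop_mult_def matrix_inv assms matrix_mul_assoc)
qed

lemma loop_conj_inv:
  assumes "invertible k" "\<And>\<theta>. invertible (f \<theta>)"
  shows "loop_conj k (loop_inv f) = loop_inv (loop_conj k f)"
  using assms
  by (simp add: loop_conj_def loop_inv_def matrix_inv_mult invertible_mult invertible_matrix_inv
      matrix_inv_matrix_inv matrix_mul_assoc)

lemma loop_conj_one: "invertible k \<Longrightarrow> loop_conj k loop_one = loop_one"
  by (simp add: loop_conj_def loop_one_def matrix_inv)

text \<open>Holding for every \<open>f\<close>, in the group or not, this makes conjugation a
  bijection of the whole loop type, as is needed to transport multiplicities of paths in boundary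
  chains.\<close>

lemma loop_conj_matrix_inv:
  assumes "invertible k"
  shows "loop_conj (matrix_inv k) (loop_conj k f) = f" "loop_conj k (loop_conj (matrix_inv k) f) = f"
proof -
  have "matrix_inv k ** (k ** A ** matrix_inv k) ** k = (matrix_inv k ** k) ** A ** (matrix_inv k ** k)"
    "k ** (matrix_inv k ** A ** k) ** matrix_inv k = (k ** matrix_inv k) ** A ** (k ** matrix_inv k)" for A
    by (simp_all only: matrix_mul_assoc)
  then show "loop_conj (matrix_inv k) (loop_conj k f) = f" "loop_conj k (loop_conj (matrix_inv k) f) = f"
    by (simp_all add: loop_conj_def matrix_inv matrix_inv_matrix_inv assms)
qed

context closed_matrix_group
begin

lemma smooth_loop_conj:
  assumes "k \<in> G" "smooth_loop G f"
  shows "smooth_loop G (loop_conj k f)"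
  using assms unfolding smooth_loop_def loop_conj_def
  by (auto intro!: smooth_conj mult_mem inv_mem)

lemma loop_conj_loop_group: "k \<in> G \<Longrightarrow> f \<in> loop_group G \<Longrightarrow> loop_conj k f \<in> loop_group G"
  by (simp add: loop_group_def smooth_loop_conj)

lemma holomorphic_conj:
  fixes F :: "complex \<Rightarrow> complex^'n^'n"
  assumes "\<And>i j. (\<lambda>z. F z $ i $ j) holomorphic_on S"
  shows "(\<lambda>z. (k ** F z ** l) $ i $ j) holomorphic_on S"
  by (intro holomorphic_matrix_mult assms holomorphic_on_const)

lemma loop_conj_L_plus:
  assumes k: "k \<in> G" and f: "f \<in> L_plus G"
  shows "loop_conj k f \<in> L_plus G"
proof -
  obtain F where F: "continuous_on (cball 0 1) F" "\<And>z. z \<in> cball 0 1 \<Longrightarrow> F z \<in> G"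
      "\<And>i j. (\<lambda>z. F z $ i $ j) holomorphic_on ball 0 1" "\<And>\<theta>. F (cis \<theta>) = f \<theta>"
    using f by (auto simp: L_plus_def)
  let ?F = "\<lambda>z. k ** F z ** matrix_inv k"
  have "continuous_on (cball 0 1) ?F"
    by (intro bounded_linear.continuous_on[OF bounded_linear_conj] F)
  moreover have "\<forall>z\<in>cball 0 1. ?F z \<in> G"
    by (intro ballI mult_mem inv_mem k F(2))
  moreover have "\<forall>i j. (\<lambda>z. ?F z $ i $ j) holomorphic_on ball 0 1"
    by (intro allI holomorphic_conj F)
  moreover have "\<forall>\<theta>. ?F (cis \<theta>) = loop_conj k f \<theta>"
    by (simp add: loop_conj_def F(4))
  ultimately show ?thesis
    using loop_conj_loop_group[OF k] f unfolding L_plus_def by blast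
qed

lemma loop_conj_L_minus:
  assumes k: "k \<in> G" and f: "f \<in> L_minus G"
  shows "loop_conj k f \<in> L_minus G"
proof -
  obtain F where F: "continuous_on {z. 1 \<le> norm z} F" "\<And>z. 1 \<le> norm z \<Longrightarrow> F z \<in> G"
      "\<And>i j. (\<lambda>z. F z $ i $ j) holomorphic_on {z. 1 < norm z}"
      "(F \<longlongrightarrow> mat 1) at_infinity" "\<And>\<theta>. F (cis \<theta>) = f \<theta>"
    using f by (auto simp: L_minus_def)
  let ?F = "\<lambda>z. k ** F z ** matrix_inv k"
  have "continuous_on {z. 1 \<le> norm z} ?F"
    by (intro bounded_linear.continuous_on[OF bounded_linear_conj] F)
  moreover have "\<forall>z. 1 \<le> norm z \<longrightarrow> ?F z \<in> G"
    using k F(2) by (auto intro: mult_mem inv_mem)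
  moreover have "\<forall>i j. (\<lambda>z. ?F z $ i $ j) holomorphic_on {z. 1 < norm z}"
    by (intro allI holomorphic_conj F)
  moreover have "(?F \<longlongrightarrow> mat 1) at_infinity"
    using bounded_linear.tendsto[OF bounded_linear_conj F(4), of k "matrix_inv k"] invertible[OF k]
    by (simp add: matrix_inv)
  moreover have "\<forall>\<theta>. ?F (cis \<theta>) = loop_conj k f \<theta>"
    by (simp add: loop_conj_def F(5))
  ultimately show ?thesis
    using loop_conj_loop_group[OF k] f unfolding L_minus_def by blast
qed

lemma L_minus_invertible: "f \<in> L_minus G \<Longrightarrow> invertible (f \<theta>)"
  by (auto simp: L_minus_def loop_group_def smooth_loop_def intro: invertible)

lemma L_plus_invertible: "f \<in> L_plus G \<Longrightarrow> invertible (f \<theta>)"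
  by (auto simp: L_plus_def loop_group_def smooth_loop_def intro: invertible)

section \<open>Uniqueness of the Birkhoff factorization\<close>

text \<open>On the circle \<open>E2 E1^-1 = M2 M1^-1\<close>. The left side extends to the disc, the
  right side to the exterior with limit 1, so by \<open>inside_outside_constant\<close> each entry
  is that of the identity.\<close>

lemma birkhoff_unique:
  assumes M: "M1 \<in> L_minus G" "M2 \<in> L_minus G" and E: "E1 \<in> L_plus G" "E2 \<in> L_plus G"
    and eq: "loop_mult (loop_inv M1) E1 = loop_mult (loop_inv M2) E2"
  shows "M1 = M2"
proof
  fix \<theta> :: real
  obtain F1 where F1: "continuous_on {z. 1 \<le> norm z} F1" "\<And>z. 1 \<le> norm z \<Longrightarrow> F1 z \<in> G"
      "\<And>i j. (\<lambda>z. F1 z $ i $ j) holomorphic_on {z. 1 < norm z}"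
      "(F1 \<longlongrightarrow> mat 1) at_infinity" "\<And>\<theta>. F1 (cis \<theta>) = M1 \<theta>"
    using M(1) by (auto simp: L_minus_def)
  obtain F2 where F2: "continuous_on {z. 1 \<le> norm z} F2"
      "\<And>i j. (\<lambda>z. F2 z $ i $ j) holomorphic_on {z. 1 < norm z}"
      "(F2 \<longlongrightarrow> mat 1) at_infinity" "\<And>\<theta>. F2 (cis \<theta>) = M2 \<theta>"
    using M(2) by (auto simp: L_minus_def)
  obtain P1 where P1: "continuous_on (cball 0 1) P1" "\<And>z. z \<in> cball 0 1 \<Longrightarrow> P1 z \<in> G"
      "\<And>i j. (\<lambda>z. P1 z $ i $ j) holomorphic_on ball 0 1" "\<And>\<theta>. P1 (cis \<theta>) = E1 \<theta>"
    using E(1) by (auto simp: L_plus_def)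
  obtain P2 where P2: "continuous_on (cball 0 1) P2"
      "\<And>i j. (\<lambda>z. P2 z $ i $ j) holomorphic_on ball 0 1" "\<And>\<theta>. P2 (cis \<theta>) = E2 \<theta>"
    using E(2) by (auto simp: L_plus_def)
  have inv_one: "matrix_inv (mat 1 :: complex^'n^'n) = mat 1"
    by (rule matrix_inv_unique) simp_all
  have circle: "E2 \<theta> ** matrix_inv (E1 \<theta>) = M2 \<theta> ** matrix_inv (M1 \<theta>)" for \<theta>
  proof -
    have "matrix_inv (M1 \<theta>) ** E1 \<theta> = matrix_inv (M2 \<theta>) ** E2 \<theta>"
      using fun_cong[OF eq, of \<theta>] by (simp add: loop_mult_def loop_inv_def)
    then have "M2 \<theta> ** (matrix_inv (M1 \<theta>) ** E1 \<theta>) ** matrix_inv (E1 \<theta>)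
        = M2 \<theta> ** (matrix_inv (M2 \<theta>) ** E2 \<theta>) ** matrix_inv (E1 \<theta>)"
      by simp
    then have "M2 \<theta> ** matrix_inv (M1 \<theta>) ** (E1 \<theta> ** matrix_inv (E1 \<theta>))
        = (M2 \<theta> ** matrix_inv (M2 \<theta>)) ** E2 \<theta> ** matrix_inv (E1 \<theta>)"
      by (simp only: matrix_mul_assoc)
    then show ?thesis
      using L_minus_invertible[OF M(2)] L_plus_invertible[OF E(1)] by (simp add: matrix_inv)
  qed
  have inv_lim: "((\<lambda>z. matrix_inv (F1 z)) \<longlongrightarrow> mat 1) at_infinity"
  proof -
    have "((\<lambda>z. matrix_inv (F1 z)) \<longlongrightarrow> matrix_inv (mat 1)) at_infinity"
    proof (rule tendsto_matrix_inv[OF F1(4)])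
      show "\<forall>\<^sub>F z in at_infinity. invertible (F1 z)"
        unfolding eventually_at_infinity using F1(2) invertible by blast
      show "invertible (mat 1 :: complex^'n^'n)"
        by (rule invertible[OF one_mem])
    qed
    then show ?thesis by (simp add: inv_one)
  qed
  have "(E2 \<theta> ** matrix_inv (E1 \<theta>)) $ i $ j = mat 1 $ i $ j" for i j
  proof -
    have "((\<lambda>z. P2 z ** matrix_inv (P1 z)) (cis \<theta>)) $ i $ j = mat 1 $ i $ j"
    proof (rule inside_outside_constant[of "\<lambda>z. (P2 z ** matrix_inv (P1 z)) $ i $ j"
            "\<lambda>z. (F2 z ** matrix_inv (F1 z)) $ i $ j"])
      show "continuous_on (cball 0 1) (\<lambda>z. (P2 z ** matrix_inv (P1 z)) $ i $ j)"
        by (intro continuous_on_component matmul.continuous_on P2 continuous_on_matrix_inv P1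
            invertible)
      show "(\<lambda>z. (P2 z ** matrix_inv (P1 z)) $ i $ j) holomorphic_on ball 0 1"
        by (intro holomorphic_matrix_mult holomorphic_matrix_inv P1 P2 invertible) auto
      show "continuous_on {z. 1 \<le> norm z} (\<lambda>z. (F2 z ** matrix_inv (F1 z)) $ i $ j)"
        by (intro continuous_on_component matmul.continuous_on F2 continuous_on_matrix_inv F1
            invertible) simp
      show "(\<lambda>z. (F2 z ** matrix_inv (F1 z)) $ i $ j) holomorphic_on {z. 1 < norm z}"
        by (intro holomorphic_matrix_mult holomorphic_matrix_inv F1 F2 invertible) simp
      have "((\<lambda>z. F2 z ** matrix_inv (F1 z)) \<longlongrightarrow> mat 1 ** mat 1) at_infinity"
        by (intro matmul.tendsto F2 inv_lim)
      then show "((\<lambda>z. (F2 z ** matrix_inv (F1 z)) $ i $ j) \<longlongrightarrow> mat 1 $ i $ j) at_infinity"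
        by (simp add: tendsto_vec_nth)
      show "(P2 (cis \<theta>) ** matrix_inv (P1 (cis \<theta>))) $ i $ j
          = (F2 (cis \<theta>) ** matrix_inv (F1 (cis \<theta>))) $ i $ j" for \<theta>
        by (simp add: P1(4) P2(3) F1(5) F2(4) circle)
    qed
    then show ?thesis
      by (simp add: P1(4) P2(3))
  qed
  then have "M2 \<theta> ** matrix_inv (M1 \<theta>) = mat 1"
    by (simp add: vec_eq_iff circle)
  then have "M2 \<theta> ** (matrix_inv (M1 \<theta>) ** M1 \<theta>) = M1 \<theta>"
    by (simp add: matrix_mul_assoc)
  then show "M1 \<theta> = M2 \<theta>"
    using L_minus_invertible[OF M(1)] by (simp add: matrix_inv)
qed

end

section \<open>Invariance of the function \<open>mu\<close> under conjugation\<close>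

lemma cscale_conj: "cscale c (k ** A ** l) = k ** cscale c A ** l"
  by (simp add: vec_eq_iff cscale_def matrix_matrix_mult_def sum_distrib_left sum_distrib_right
      mult_ac)

lemma vector_derivative_conj:
  fixes \<xi> :: "real \<Rightarrow> complex^'n^'n"
  assumes "\<xi> differentiable at \<theta>"
  shows "vector_derivative (\<lambda>r. k ** \<xi> r ** l) (at \<theta>) = k ** vector_derivative \<xi> (at \<theta>) ** l"
  using assms
  by (intro vector_derivative_at bounded_linear.has_vector_derivative[OF bounded_linear_conj])
    (simp add: vector_derivative_works)

text \<open>From \<open>B^-1 - A^-1 = - B^-1 (B - A) A^-1\<close> and continuity of the inverse. It
  serves for the angle variable, where a loop stays invertible for all real arguments.\<close>

lemma differentiable_matrix_inv:
  fixes f :: "real \<Rightarrow> complex^'n^'n"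
  assumes "f differentiable at x" "\<And>y. invertible (f y)"
  shows "(\<lambda>y. matrix_inv (f y)) differentiable at x"
proof -
  obtain D where D: "(f has_vector_derivative D) (at x)"
    using assms(1) by (auto simp: vector_derivative_works)
  then have "isCont f x"
    by (rule has_vector_derivative_continuous)
  then have lim: "((\<lambda>h. f (x + h)) \<longlongrightarrow> f x) (at 0)"
    by (simp add: isCont_iff)
  have "((\<lambda>h. - (matrix_inv (f (x + h)) ** ((f (x + h) - f x) /\<^sub>R h) ** matrix_inv (f x)))
      \<longlongrightarrow> - (matrix_inv (f x) ** D ** matrix_inv (f x))) (at 0)"
    using D unfolding has_vector_derivative_iff_quotient
    by (intro tendsto_minus matmul.tendsto tendsto_matrix_inv lim assms(2) tendsto_const
        always_eventually allI)
  moreover have "- (matrix_inv (f (x + h)) ** ((f (x + h) - f x) /\<^sub>R h) ** matrix_inv (f x))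
      = (matrix_inv (f (x + h)) - matrix_inv (f x)) /\<^sub>R h" for h
  proof -
    have "matrix_inv (f (x + h)) ** (f (x + h) - f x) ** matrix_inv (f x)
        = matrix_inv (f (x + h)) ** f (x + h) ** matrix_inv (f x)
          - matrix_inv (f (x + h)) ** (f x ** matrix_inv (f x))"
      by (simp add: matmul.diff_left matmul.diff_right matrix_mul_assoc)
    also have "\<dots> = matrix_inv (f x) - matrix_inv (f (x + h))"
      by (simp add: matrix_inv assms(2))
    finally show ?thesis
      by (simp only: matmul.scaleR_left matmul.scaleR_right) (simp add: scaleR_diff_right)
  qed
  ultimately have "((\<lambda>y. matrix_inv (f y)) has_vector_derivative
      - (matrix_inv (f x) ** D ** matrix_inv (f x))) (at x)"
    by (simp add: has_vector_derivative_iff_quotient)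
  then show ?thesis
    by (auto simp: has_vector_derivative_def differentiable_def)
qed

section \<open>Boundary chains under a bijection of loops\<close>

text \<open>A chain sees only the restrictions to \<open>[0,1]\<close>. This matters because
  identities between conjugated edges are available only where the loops are known to be
  invertible.\<close>

lemma path_chain_cong:
  assumes "map (\<lambda>p. restrict p {0..1}) ps = map (\<lambda>p. restrict p {0..1}) qs"
  shows "path_chain ps = path_chain qs"
  unfolding path_chain_def by (simp only: assms)

lemma count_list_map_inverse:
  assumes "\<And>x. g (h x) = x" "\<And>y. h (g y) = y"
  shows "count_list (map h xs) y = count_list xs (g y)"
  using assms by (induction xs) auto

text \<open>\<open>path_chain\<close> counts paths that are \<open>undefined\<close> outside \<open>[0,1]\<close>, so \<open>C\<close> may only act inside.\<close>

lemma path_chain_map: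
  assumes "\<And>x. C' (C x) = x" "\<And>x. C (C' x) = x"
  shows "path_chain (map (\<lambda>p s. C (p s)) ps) q
    = path_chain ps (\<lambda>s. if s \<in> {0..1} then C' (q s) else q s)"
proof -
  define h where "h p = (\<lambda>s. if s \<in> {0..1::real} then C (p s) else p s)" for p
  define g where "g p = (\<lambda>s. if s \<in> {0..1::real} then C' (p s) else p s)" for p
  have gh: "g (h p) = p" "h (g p) = p" for p
    using assms by (auto simp: g_def h_def)
  have "map (\<lambda>p. restrict p {0..1}) (map (\<lambda>p s. C (p s)) ps)
      = map h (map (\<lambda>p. restrict p {0..1}) ps)"
    by (auto simp: h_def restrict_def)
  \<comment> \<open>The substitution \<open>1 - s\<close> preserves \<open>[0,1]\<close> and its
    complement, so the case distinction in \<open>g\<close> is compatible with reversal.\<close>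
  moreover have "g (reversepath q) = reversepath (g q)"
    by (auto simp: g_def reversepath_def)
  ultimately show ?thesis
    unfolding path_chain_def g_def[symmetric]
    by (simp only: Let_def count_list_map_inverse[of g h, OF gh])
qed

context closed_matrix_group
begin

text \<open>The elements \<open>p(s)^-1 p(s + r)\<close> tend to 1 with quotient limit
  \<open>p(s)^-1 D\<close>, but are known to be in \<open>G\<close> only while \<open>s + r\<close>
  stays in \<open>[0,1]\<close>. So \<open>s < 1\<close> is approached from the right; at
  \<open>s = 1\<close> the approach from the left yields the negative vector.\<close>

lemma velocity_mem:
  assumes p: "\<And>r. r \<in> {0..1} \<Longrightarrow> p r \<in> G" and s: "s \<in> {0..1}"
    and D: "(p has_vector_derivative D) (at s)"
  shows "matrix_inv (p s) ** D \<in> lie_algebra G"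
proof -
  have lim: "(\<lambda>n. (matrix_inv (p s) ** p (s + r n) - mat 1) /\<^sub>R r n) \<longlonglongrightarrow> matrix_inv (p s) ** D"
    if "\<And>n. r n \<noteq> 0" "r \<longlonglongrightarrow> 0" for r
  proof -
    have "(\<lambda>n. matrix_inv (p s) ** ((p (s + r n) - p s) /\<^sub>R r n)) \<longlonglongrightarrow> matrix_inv (p s) ** D"
      by (intro matmul.tendsto tendsto_const has_vector_derivative_quotient_sequentially D that)
    then show ?thesis
      using p[OF s] by (simp add: matmul.scaleR_right matmul.diff_right matrix_inv invertible)
  qed
  have h_mem: "matrix_inv (p s) ** p r \<in> G" if "r \<in> {0..1}" for r
    by (intro mult_mem inv_mem p s that)
  have null: "(\<lambda>n. c * (1 / real (Suc n))) \<longlonglongrightarrow> 0" for c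
    using tendsto_mult[OF tendsto_const[of c] LIMSEQ_Suc[OF lim_inverse_n']] by simp
  show ?thesis
  proof (cases "s < 1")
    case True
    \<comment> \<open>The factor \<open>1 - s\<close> keeps \<open>s + r n\<close> at most
      1.\<close>
    define r where "r n = (1 - s) * (1 / real (Suc n))" for n
    have pos: "r n > 0" for n
      using True by (simp add: r_def)
    have "r n \<le> 1 - s" for n
      unfolding r_def using True by (intro mult_left_le) auto
    then have "s + r n \<in> {0..1}" for n
      using s pos[of n] by (auto simp: le_diff_eq add.commute)
    then show ?thesis
      using pos null[of "1 - s"] True
      by (intro lie_algebra_limit[OF _ _ _ lim] h_mem) (simp_all add: r_def less_imp_neq[symmetric])
  next
    case False
    then have [simp]: "s = 1" using s by simp
    define r where "r n = 1 / real (Suc n)" for n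
    have pos: "r n > 0" for n
      by (simp add: r_def)
    have "r n \<le> 1" for n
      by (simp add: r_def)
    then have mem: "s + - r n \<in> {0..1}" for n
      using pos[of n] by (auto simp: less_imp_le)
    have r_lim: "r \<longlonglongrightarrow> 0"
      using null[of 1] by (simp add: r_def[abs_def])
    have "(\<lambda>n. (matrix_inv (p s) ** p (s + - r n) - mat 1) /\<^sub>R (- r n)) \<longlonglongrightarrow> matrix_inv (p s) ** D"
      using pos tendsto_minus[OF r_lim] by (intro lim) (auto simp: less_imp_neq[symmetric])
    from tendsto_minus[OF this]
    have "(\<lambda>n. (matrix_inv (p s) ** p (s + - r n) - mat 1) /\<^sub>R r n) \<longlonglongrightarrow> - (matrix_inv (p s) ** D)"
      by simp
    then have "- (matrix_inv (p s) ** D) \<in> lie_algebra G"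
      using mem pos r_lim by (intro lie_algebra_limit[of "\<lambda>n. matrix_inv (p s) ** p (s + - r n)" r] h_mem)
    then show ?thesis
      using lie_algebra_scaleR[of "- (matrix_inv (p s) ** D)" "-1"] by simp
  qed
qed

section \<open>The cocycle, its pullback and surface integrals under conjugation\<close>

text \<open>The integrands agree pointwise by \<open>invariant_form_Ad\<close>, once
  \<open>loop_deriv \<xi>\<close> is in the Lie algebra: derivatives stay in a closed subspace, and
  the factor \<open>1 / (\<i> * cis \<theta>)\<close> calls for a complex one.\<close>

lemma cocycle_conj:
  assumes "connected G" and csub: "csubspace (lie_algebra G)"
    and inv: "invariant_form (lie_algebra G) B" and k: "k \<in> G"
    and \<xi>: "\<And>\<theta>. \<xi> \<theta> \<in> lie_algebra G" "\<And>\<theta>. \<xi> differentiable at \<theta>"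
    and \<eta>: "\<And>\<theta>. \<eta> \<theta> \<in> lie_algebra G"
  shows "cocycle B (loop_conj k \<xi>) (loop_conj k \<eta>) = cocycle B \<xi> \<eta>"
proof -
  have sub: "subspace (lie_algebra G)"
    by (rule csubspace_imp_subspace[OF csub])
  have "vector_derivative \<xi> (at \<theta>) \<in> lie_algebra G" for \<theta>
    by (rule derivative_in_closed_subspace[OF vector_derivative_works[THEN iffD1, OF \<xi>(2)] \<xi>(1)
          sub closed_subspace[OF sub]])
  then have mem: "loop_deriv \<xi> \<theta> \<in> lie_algebra G" for \<theta>
    using csub by (auto simp: loop_deriv_def csubspace_def)
  have "loop_deriv (loop_conj k \<xi>) \<theta> = k ** loop_deriv \<xi> \<theta> ** matrix_inv k" for \<theta>
    by (simp add: loop_deriv_def loop_conj_def vector_derivative_conj \<xi>(2) cscale_conj)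
  then have "B (loop_deriv (loop_conj k \<xi>) \<theta>) (loop_conj k \<eta> \<theta>) = B (loop_deriv \<xi> \<theta>) (\<eta> \<theta>)" for \<theta>
    using invariant_form_Ad[OF assms(1) sub inv k mem \<eta>] by (simp add: loop_conj_def)
  then show ?thesis
    by (simp add: cocycle_def loop_pairing_def)
qed

text \<open>The left translated velocities are conjugated along with the square, since
  \<open>(k A k^-1)^-1 (k D k^-1) = k (A^-1 D) k^-1\<close>; then \<open>cocycle_conj\<close>
  applies.\<close>

lemma cocycle_pullback_conj:
  assumes "connected G" and csub: "csubspace (lie_algebra G)"
    and inv: "invariant_form (lie_algebra G) B" and k: "k \<in> G"
    and \<sigma>: "smooth_square_in (loop_group G) \<sigma>" and st: "s \<in> {0..1}" "t \<in> {0..1}"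
  shows "cocycle_pullback B (\<lambda>x. loop_conj k (\<sigma> x)) (s, t) = cocycle_pullback B \<sigma> (s, t)"
proof -
  define S where "S = (\<lambda>(x, \<theta>). \<sigma> x \<theta>)"
  have S: "smooth S"
    using \<sigma> by (simp add: smooth_square_in_def S_def)
  have S_mem: "S ((r, r'), \<theta>) \<in> G" if "r \<in> {0..1}" "r' \<in> {0..1}" for r r' \<theta>
    using \<sigma> that by (auto simp: smooth_square_in_def S_def loop_group_def smooth_loop_def)
  have S_inv: "invertible (S ((s, t), \<theta>))" for \<theta>
    by (intro invertible S_mem st)
  have curve: "((\<lambda>r. S (c r)) has_vector_derivative frechet_derivative S (at (c u)) c') (at u)"
    if "(c has_vector_derivative c') (at u)" for c c' and u :: real
    using has_derivative_compose[OF that[unfolded has_vector_derivative_def] smooth_has_derivative[OF S]]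
    unfolding has_vector_derivative_def
    by (simp add: linear_scale[OF has_derivative_linear[OF smooth_has_derivative[OF S]]])
  \<comment> \<open>As directional derivatives of the joint map \<open>S\<close>, the two velocities
    are smooth in all variables; in particular \<open>D1\<close> can be differentiated in the angle,
    as the cocycle requires.\<close>
  define D1 where "D1 \<theta> = frechet_derivative S (at ((s, t), \<theta>)) ((1, 0), 0)" for \<theta>
  define D2 where "D2 \<theta> = frechet_derivative S (at ((s, t), \<theta>)) ((0, 1), 0)" for \<theta>
  have D1: "((\<lambda>r. S ((r, t), \<theta>)) has_vector_derivative D1 \<theta>) (at s)" for \<theta>
    unfolding D1_def
    by (rule curve[of "\<lambda>r. ((r, t), \<theta>)"]) (auto intro!: derivative_eq_intros simp: has_vector_derivative_Pair)
  have D2: "((\<lambda>r. S ((s, r), \<theta>)) has_vector_derivative D2 \<theta>) (at t)" for \<theta>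
    unfolding D2_def
    by (rule curve[of "\<lambda>r. ((s, r), \<theta>)"]) (auto intro!: derivative_eq_intros)
  have diff_\<theta>: "(\<lambda>\<theta>. T ((s, t), \<theta>)) differentiable at \<theta>"
    if "smooth T" for T :: "_ \<Rightarrow> complex^'n^'n" and \<theta> :: real
  proof -
    have "(T has_derivative frechet_derivative T (at ((s, t), \<theta>))) (at ((s, t), \<theta>))"
      by (rule smooth_has_derivative[OF that])
    moreover have "((\<lambda>\<theta>. ((s, t), \<theta>)) has_derivative (\<lambda>h. ((0, 0), h))) (at \<theta>)"
      by (auto intro!: derivative_eq_intros simp: zero_prod_def)
    ultimately show ?thesis
      using has_derivative_compose unfolding differentiable_def by blast
  qed
  define \<xi> where "\<xi> \<theta> = matrix_inv (S ((s, t), \<theta>)) ** D1 \<theta>" for \<theta>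
  define \<eta> where "\<eta> \<theta> = matrix_inv (S ((s, t), \<theta>)) ** D2 \<theta>" for \<theta>
  have \<xi>_mem: "\<xi> \<theta> \<in> lie_algebra G" for \<theta>
    unfolding \<xi>_def using velocity_mem[OF _ st(1) D1] S_mem st(2) by auto
  have \<eta>_mem: "\<eta> \<theta> \<in> lie_algebra G" for \<theta>
    unfolding \<eta>_def using velocity_mem[OF _ st(2) D2] S_mem st(1) by auto
  have \<xi>_diff: "\<xi> differentiable at \<theta>" for \<theta>
  proof -
    have "(\<lambda>\<theta>. matrix_inv (S ((s, t), \<theta>))) differentiable at \<theta>"
      by (intro differentiable_matrix_inv diff_\<theta> S S_inv)
    moreover have "D1 differentiable at \<theta>"
      unfolding D1_def by (rule diff_\<theta>[OF smooth_frechet_derivative[OF S]])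
    ultimately show ?thesis
      unfolding \<xi>_def differentiable_def using matmul.FDERIV by blast
  qed
  have eq: "matrix_inv (k ** A ** matrix_inv k) ** (k ** D ** matrix_inv k)
      = k ** (matrix_inv A ** D) ** matrix_inv k" if "invertible A" for A D
  proof -
    have "matrix_inv (k ** A ** matrix_inv k) = k ** matrix_inv A ** matrix_inv k"
      using that invertible[OF k]
      by (simp add: matrix_inv_mult invertible_mult invertible_matrix_inv matrix_inv_matrix_inv
          matrix_mul_assoc)
    then have "matrix_inv (k ** A ** matrix_inv k) ** (k ** D ** matrix_inv k)
        = k ** matrix_inv A ** (matrix_inv k ** k) ** D ** matrix_inv k"
      by (simp add: matrix_mul_assoc)
    then show ?thesis
      using invertible[OF k] by (simp add: matrix_inv matrix_mul_assoc)
  qed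
  have S_eq: "\<sigma> (r, r') \<theta> = S ((r, r'), \<theta>)" for r r' \<theta>
    by (simp add: S_def)
  have vd: "vector_derivative (\<lambda>r. loop_conj k (\<sigma> (r, t)) \<theta>) (at s) = k ** D1 \<theta> ** matrix_inv k"
    "vector_derivative (\<lambda>r. loop_conj k (\<sigma> (s, r)) \<theta>) (at t) = k ** D2 \<theta> ** matrix_inv k"
    "vector_derivative (\<lambda>r. \<sigma> (r, t) \<theta>) (at s) = D1 \<theta>"
    "vector_derivative (\<lambda>r. \<sigma> (s, r) \<theta>) (at t) = D2 \<theta>" for \<theta>
    unfolding loop_conj_def S_eq
    by (intro vector_derivative_at D1 D2 bounded_linear.has_vector_derivative[OF bounded_linear_conj])+
  have "cocycle_pullback B (\<lambda>x. loop_conj k (\<sigma> x)) (s, t) = cocycle B (loop_conj k \<xi>) (loop_conj k \<eta>)"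
    unfolding cocycle_pullback_def case_prod_conv vd
    by (simp add: loop_conj_def S_eq eq[OF S_inv] \<xi>_def \<eta>_def)
  also have "\<dots> = cocycle B \<xi> \<eta>"
    by (rule cocycle_conj[OF assms(1) csub inv k \<xi>_mem \<xi>_diff \<eta>_mem])
  also have "\<dots> = cocycle_pullback B \<sigma> (s, t)"
    unfolding cocycle_pullback_def case_prod_conv vd by (simp add: S_eq \<xi>_def[abs_def] \<eta>_def[abs_def])
  finally show ?thesis .
qed

lemma smooth_square_conj:
  assumes "k \<in> G" "smooth_square_in (loop_group G) \<sigma>"
  shows "smooth_square_in (loop_group G) (\<lambda>x. loop_conj k (\<sigma> x))"
proof -
  have "(\<lambda>(x, \<theta>). loop_conj k (\<sigma> x) \<theta>) = (\<lambda>z. k ** (case z of (x, \<theta>) \<Rightarrow> \<sigma> x \<theta>) ** matrix_inv k)"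
    by (auto simp: loop_conj_def)
  with assms show ?thesis
    unfolding smooth_square_in_def by (auto intro: smooth_conj loop_conj_loop_group)
qed

lemma smooth_path_conj:
  assumes "smooth_path_in S p" "\<And>f. f \<in> S \<Longrightarrow> loop_conj k f \<in> S"
  shows "smooth_path_in S (\<lambda>s. loop_conj k (p s))"
proof -
  have "(\<lambda>(s, \<theta>). loop_conj k (p s) \<theta>) = (\<lambda>z. k ** (case z of (s, \<theta>) \<Rightarrow> p s \<theta>) ** matrix_inv k)"
    by (auto simp: loop_conj_def)
  with assms show ?thesis
    unfolding smooth_path_in_def by (auto intro: smooth_conj)
qed

lemma surface_integral_conj:
  assumes "connected G" "csubspace (lie_algebra G)" "invariant_form (lie_algebra G) B" "k \<in> G"
    and "surface_in (loop_group G) \<Omega>"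
  shows "surface_integral B (map (\<lambda>\<sigma> x. loop_conj k (\<sigma> x)) \<Omega>) = surface_integral B \<Omega>"
proof -
  have "integral ({0..1} \<times> {0..1}) (cocycle_pullback B (\<lambda>x. loop_conj k (\<sigma> x)))
      = integral ({0..1} \<times> {0..1}) (cocycle_pullback B \<sigma>)" if "\<sigma> \<in> set \<Omega>" for \<sigma>
    using assms that
    by (intro Henstock_Kurzweil_Integration.integral_cong)
      (auto simp: surface_in_def intro!: cocycle_pullback_conj)
  then show ?thesis
    by (simp add: surface_integral_def o_def cong: map_cong)
qed

text \<open>Every witness is conjugated: factors, paths and squares. The number \<open>z\<close> is
  kept because the surface integral does not change.\<close>

lemma is_mu_value_conj:
  assumes G: "connected G" "csubspace (lie_algebra G)" "invariant_form (lie_algebra G) B" "k \<in> G"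
    and mu: "is_mu_value G B g z"
  shows "is_mu_value G B (loop_conj k g) z"
proof -
  obtain fp fm gp gm cp cm dp dm \<Omega> where
    f: "fp \<in> L_plus G" "fm \<in> L_minus G" "gp \<in> L_plus G" "gm \<in> L_minus G" and
    g: "g = loop_mult fp (loop_inv fm)" "g = loop_mult (loop_inv gm) gp" and
    cp: "smooth_path_in (L_plus G) cp" "cp 0 = loop_one" "cp 1 = fp" and
    cm: "smooth_path_in (L_minus G) cm" "cm 0 = loop_one" "cm 1 = fm" and
    dp: "smooth_path_in (L_plus G) dp" "dp 0 = loop_one" "dp 1 = gp" and
    dm: "smooth_path_in (L_minus G) dm" "dm 0 = loop_one" "dm 1 = gm" and
    \<Omega>: "surface_in (loop_group G) \<Omega>" "surface_boundary \<Omega> = path_chain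
          [cp, \<lambda>s. loop_mult fp (loop_inv (cm s)),
           reversepath (\<lambda>s. loop_mult (loop_inv gm) (dp s)),
           reversepath (\<lambda>s. loop_inv (dm s))]" "z = exp (surface_integral B \<Omega>)"
    using mu unfolding is_mu_value_def by blast
  have k: "invertible k"
    by (rule invertible[OF G(4)])
  let ?c = "loop_conj k" and ?cs = "\<lambda>p (s::real). loop_conj k (p s)"
  define \<Omega>' where "\<Omega>' = map (\<lambda>\<sigma> x. loop_conj k (\<sigma> x)) \<Omega>"
  have edges: "concat (map square_edges \<Omega>') = map ?cs (concat (map square_edges \<Omega>))"
    by (simp add: \<Omega>'_def map_concat square_edges_def reversepath_def o_def)
  have cm_mem: "cm s \<in> L_minus G" and dm_mem: "dm s \<in> L_minus G" if "s \<in> {0..1}" for s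
    using cm(1) dm(1) that by (simp_all add: smooth_path_in_def)
  have map: "path_chain (map ?cs ps) q
      = path_chain ps (\<lambda>s. if s \<in> {0..1} then loop_conj (matrix_inv k) (q s) else q s)" for ps q
    by (rule path_chain_map) (rule loop_conj_matrix_inv[OF k])+
  \<comment> \<open>The given boundary condition equates chains, not lists of edges. By
    \<open>map\<close>, the chain of the conjugated paths is determined by the chain of the original
    ones.\<close>
  have "path_chain (map ?cs ps) = path_chain (map ?cs qs)" if "path_chain ps = path_chain qs" for ps qs
    by (rule ext) (simp only: map that)
  from this[OF \<Omega>(2)[unfolded surface_boundary_def]]
  have "surface_boundary \<Omega>' = path_chain (map ?cs
          [cp, \<lambda>s. loop_mult fp (loop_inv (cm s)),
           reversepath (\<lambda>s. loop_mult (loop_inv gm) (dp s)),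
           reversepath (\<lambda>s. loop_inv (dm s))])"
    unfolding surface_boundary_def edges .
  also have "\<dots> = path_chain
          [?cs cp, \<lambda>s. loop_mult (?c fp) (loop_inv (?c (cm s))),
           reversepath (\<lambda>s. loop_mult (loop_inv (?c gm)) (?c (dp s))),
           reversepath (\<lambda>s. loop_inv (?c (dm s)))]"
  proof (rule path_chain_cong, simp only: list.map,
      intro refl arg_cong2[where f = Cons] restrict_ext)
    \<comment> \<open>Moving conjugation through an inverse needs invertibility, hence parameters in
      \<open>[0,1]\<close>; reversed paths are evaluated at \<open>1 - s\<close>.\<close>
    fix s :: real assume s: "s \<in> {0..1}"
    then have s': "1 - s \<in> {0..1}" by auto
    show "?c (loop_mult fp (loop_inv (cm s))) = loop_mult (?c fp) (loop_inv (?c (cm s)))"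
      by (simp only: loop_conj_mult[OF k] loop_conj_inv[OF k L_minus_invertible[OF cm_mem[OF s]]])
    show "?c (reversepath (\<lambda>s. loop_mult (loop_inv gm) (dp s)) s)
        = reversepath (\<lambda>s. loop_mult (loop_inv (?c gm)) (?c (dp s))) s"
      by (simp only: reversepath_def loop_conj_mult[OF k] loop_conj_inv[OF k L_minus_invertible[OF f(4)]])
    show "?c (reversepath (\<lambda>s. loop_inv (dm s)) s) = reversepath (\<lambda>s. loop_inv (?c (dm s))) s"
      by (simp only: reversepath_def loop_conj_inv[OF k L_minus_invertible[OF dm_mem[OF s']]])
  qed
  finally have boundary: "surface_boundary \<Omega>' = \<dots>" .
  have "?c g = loop_mult (?c fp) (loop_inv (?c fm))" "?c g = loop_mult (loop_inv (?c gm)) (?c gp)"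
    by (simp only: g(1) loop_conj_mult[OF k] loop_conj_inv[OF k L_minus_invertible[OF f(2)]])
      (simp only: g(2) loop_conj_mult[OF k] loop_conj_inv[OF k L_minus_invertible[OF f(4)]])
  moreover have "surface_in (loop_group G) \<Omega>'"
    using \<Omega>(1) smooth_square_conj[OF G(4)] by (auto simp: surface_in_def \<Omega>'_def)
  moreover have "z = exp (surface_integral B \<Omega>')"
    unfolding \<Omega>'_def \<Omega>(3) by (simp only: surface_integral_conj[OF G \<Omega>(1)])
  moreover have "?c fp \<in> L_plus G" "?c gp \<in> L_plus G" "?c fm \<in> L_minus G" "?c gm \<in> L_minus G"
    using f G(4) by (auto intro: loop_conj_L_plus loop_conj_L_minus)
  moreover have "smooth_path_in (L_plus G) (?cs cp)" "?cs cp 0 = loop_one" "?cs cp 1 = ?c fp"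
    "smooth_path_in (L_minus G) (?cs cm)" "?cs cm 0 = loop_one" "?cs cm 1 = ?c fm"
    "smooth_path_in (L_plus G) (?cs dp)" "?cs dp 0 = loop_one" "?cs dp 1 = ?c gp"
    "smooth_path_in (L_minus G) (?cs dm)" "?cs dm 0 = loop_one" "?cs dm 1 = ?c gm"
    using cp cm dp dm G(4)
    by (auto intro!: smooth_path_conj loop_conj_L_plus loop_conj_L_minus simp: loop_conj_one k)
  ultimately show ?thesis
    unfolding is_mu_value_def using boundary by blast
qed

text \<open>As \<open>mu\<close> is a definite description, it suffices that the defining predicates
  agree; the converse implication is \<open>is_mu_value_conj\<close> for the inverse of
  \<open>k\<close>.\<close>

lemma mu_conj:
  assumes "connected G" "csubspace (lie_algebra G)" "invariant_form (lie_algebra G) B" "k \<in> G"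
  shows "mu G B (loop_conj k g) = mu G B g"
proof -
  have "is_mu_value G B (loop_conj k g) z \<longleftrightarrow> is_mu_value G B g z" for z
    using is_mu_value_conj[OF assms] is_mu_value_conj[OF assms(1-3) inv_mem[OF assms(4)], of "loop_conj k g"]
    by (auto simp: loop_conj_matrix_inv invertible[OF assms(4)])
  then show ?thesis
    by (simp add: mu_def)
qed

end

section \<open>The scattering solution\<close>

lemma fourier_coeff_conj:
  assumes "continuous_on {0..2 * pi} X"
  shows "fourier_coeff (loop_conj k X) m = k ** fourier_coeff X m ** matrix_inv k"
proof -
  have "continuous_on {0..2 * pi} (\<lambda>\<theta>. cscale (cis (- of_int m * \<theta>)) (X \<theta>))"
    unfolding cscale_def by (intro continuous_intros assms)
  from integral_linear[OF integrable_continuous_interval[OF this] bounded_linear_conj,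
      of k "matrix_inv k"]
  have "integral {0..2 * pi} (\<lambda>\<theta>. k ** cscale (cis (- of_int m * \<theta>)) (X \<theta>) ** matrix_inv k)
      = k ** integral {0..2 * pi} (\<lambda>\<theta>. cscale (cis (- of_int m * \<theta>)) (X \<theta>)) ** matrix_inv k"
    by (simp only: o_def)
  then show ?thesis
    by (simp add: fourier_coeff_def loop_conj_def cscale_conj matmul.scaleR_left matmul.scaleR_right)
qed

text \<open>Vanishing of the coefficients from \<open>n\<close> on makes the series finite, hence
  summable, so that a bounded linear map passes through \<open>suminf\<close>.\<close>

lemma plus_part_conj:
  assumes "continuous_on {0..2 * pi} X" and "\<And>m. m \<ge> n \<Longrightarrow> fourier_coeff X (int m) = 0"
  shows "plus_part (loop_conj k X) = loop_conj k (plus_part X)"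
proof
  fix \<theta>
  have "summable (\<lambda>m. cscale (cis (real m * \<theta>)) (fourier_coeff X (int m)))"
    by (rule summable_finite[of "{..<n}"]) (auto simp: assms(2) cscale_def vec_eq_iff)
  from bounded_linear.suminf[OF bounded_linear_conj this, of k "matrix_inv k"]
  show "plus_part (loop_conj k X) \<theta> = loop_conj k (plus_part X) \<theta>"
    by (simp only: plus_part_def fourier_coeff_conj[OF assms(1)] cscale_conj)
      (simp only: loop_conj_def)
qed

lemma mat_poly_conj:
  assumes "invertible k"
  shows "mat_poly p (k ** A ** matrix_inv k) = k ** mat_poly p A ** matrix_inv k"
proof -
  have "k ** mat_poly p A ** matrix_inv k
      = (\<Sum>i\<le>degree p. k ** cscale (coeff p i) (mat_power A i) ** matrix_inv k)"
    unfolding mat_poly_def by (rule linear_sum[OF bounded_linear.linear[OF bounded_linear_conj]])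
  then show ?thesis
    by (simp add: mat_poly_def mat_power_conj assms cscale_conj)
qed

context closed_matrix_group
begin

section \<open>The centralizer and the factorization\<close>

text \<open>At each angle, \<open>is_matrix_function\<close> presents \<open>J j \<theta>\<close> as
  a scalar times a polynomial in \<open>J 1 \<theta>\<close>, which \<open>k\<close> fixes. The
  polynomial may vary with the angle, so the argument is pointwise.\<close>

lemma vacuum_flow_conj:
  assumes k: "k \<in> centralizer_in G a" and J1: "J 1 = (\<lambda>\<theta>. cscale (cis \<theta>) a)"
    and J: "vacuum_sequence (lie_algebra G) J"
  shows "loop_conj k (vacuum_flow J N t) = vacuum_flow J N t"
proof
  fix \<theta>
  have kG: "invertible k" and ka: "k ** a = a ** k"
    using k invertible by (auto simp: centralizer_in_def)
  have "k ** a ** matrix_inv k = a ** (k ** matrix_inv k)"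
    by (simp add: ka matrix_mul_assoc)
  then have "k ** a ** matrix_inv k = a"
    by (simp add: matrix_inv kG)
  then have "k ** J 1 \<theta> ** matrix_inv k = J 1 \<theta>"
    by (simp only: J1 cscale_conj[symmetric])
  then have J_conj: "k ** J j \<theta> ** matrix_inv k = J j \<theta>" if j: "j \<ge> 1" for j
  proof -
    obtain \<phi> s where "\<And>\<theta>. \<exists>A. is_matrix_function \<phi> (J 1 \<theta>) A \<and> J j \<theta> = cscale (cis \<theta> powi s) A"
      using J j unfolding vacuum_sequence_def by blast
    then obtain p where "J j \<theta> = cscale (cis \<theta> powi s) (mat_poly p (J 1 \<theta>))"
      unfolding is_matrix_function_def by blast
    then show ?thesis
      using mat_poly_conj[OF kG, of p "J 1 \<theta>"] \<open>k ** J 1 \<theta> ** matrix_inv k = J 1 \<theta>\<close>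
      by (simp flip: cscale_conj)
  qed
  have "k ** (\<Sum>j=1..N. t j *\<^sub>R J j \<theta>) ** matrix_inv k
      = (\<Sum>j=1..N. k ** (t j *\<^sub>R J j \<theta>) ** matrix_inv k)"
    by (rule linear_sum[OF bounded_linear.linear[OF bounded_linear_conj]])
  also have "\<dots> = (\<Sum>j=1..N. t j *\<^sub>R J j \<theta>)"
    by (intro sum.cong refl) (simp add: matmul.scaleR_left matmul.scaleR_right J_conj)
  finally show "loop_conj k (vacuum_flow J N t) \<theta> = vacuum_flow J N t \<theta>"
    by (simp add: loop_conj_def vacuum_flow_def flip: mat_exp_conj[OF kG])
qed

lemma centralizer_inv:
  assumes "k \<in> centralizer_in G a"
  shows "matrix_inv k \<in> centralizer_in G a"
proof -
  have k: "k \<in> G" "k ** a = a ** k"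
    using assms by (auto simp: centralizer_in_def)
  have "matrix_inv k ** (k ** a) ** matrix_inv k = matrix_inv k ** (a ** k) ** matrix_inv k"
    by (simp add: k(2))
  then have "(matrix_inv k ** k) ** a ** matrix_inv k = matrix_inv k ** a ** (k ** matrix_inv k)"
    by (simp only: matrix_mul_assoc)
  then show ?thesis
    using k inv_mem by (simp add: centralizer_in_def matrix_inv invertible)
qed

lemma factor_unique:
  assumes "is_factor G J N f t M1" "is_factor G J N f t M2"
  shows "M1 = M2"
  using assms birkhoff_unique unfolding is_factor_def by metis

text \<open>Since \<open>J 1\<close> is linear in the loop parameter, \<open>M J\<^sub>1 M\<^sup>-\<^sup>1\<close> has no Fourier coefficients beyond
  degree one, so its \<open>plus_part\<close> is a finite sum.\<close>

lemma fourier_coeff_dressed: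
  assumes M: "M \<in> L_minus G" and J1: "J1 = (\<lambda>\<theta>. cscale (cis \<theta>) a)"
  defines "X \<equiv> loop_mult (loop_mult M J1) (loop_inv M)"
  shows "continuous_on A X" and "m \<ge> 2 \<Longrightarrow> fourier_coeff X (int m) = 0"
proof -
  obtain F where F: "continuous_on {z. 1 \<le> norm z} F" "\<And>z. 1 \<le> norm z \<Longrightarrow> F z \<in> G"
      "\<And>i j. (\<lambda>z. F z $ i $ j) holomorphic_on {z. 1 < norm z}"
      "(F \<longlongrightarrow> mat 1) at_infinity" "\<And>\<theta>. F (cis \<theta>) = M \<theta>"
    using M by (auto simp: L_minus_def)
  define H where "H z = F z ** a ** matrix_inv (F z)" for z
  have inv_lim: "((\<lambda>z. matrix_inv (F z)) \<longlongrightarrow> matrix_inv (mat 1)) at_infinity"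
  proof (rule tendsto_matrix_inv[OF F(4)])
    show "\<forall>\<^sub>F z in at_infinity. invertible (F z)"
      unfolding eventually_at_infinity using F(2) invertible by blast
  qed (rule invertible[OF one_mem])
  have H_cont: "continuous_on {z. 1 \<le> norm z} H"
    unfolding H_def
    by (intro matmul.continuous_on continuous_on_const F(1) continuous_on_matrix_inv invertible F(2)) simp
  have H_hol: "(\<lambda>z. H z $ i $ j) holomorphic_on {z. 1 < norm z}" for i j
    unfolding H_def
    by (intro holomorphic_matrix_mult holomorphic_matrix_inv holomorphic_on_const F(3) invertible F(2)) simp
  have H_lim: "(H \<longlongrightarrow> mat 1 ** a ** matrix_inv (mat 1)) at_infinity"
    unfolding H_def by (intro matmul.tendsto F(4) inv_lim tendsto_const)
  \<comment> \<open>The dressed loop is \<lambda> times a function holomorphic outside with a limit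
    at infinity.\<close>
  have X: "X \<theta> = cscale (cis \<theta>) (H (cis \<theta>))" for \<theta>
    by (simp add: X_def J1 loop_mult_def loop_inv_def H_def F(5))
      (simp add: cscale_def matrix_matrix_mult_def vec_eq_iff sum_distrib_left mult_ac)
  have Hcis: "continuous_on B (\<lambda>\<theta>. H (cis \<theta>))" for B
    by (rule continuous_on_compose2[OF H_cont]) (auto intro: continuous_intros)
  then have X_cont: "continuous_on B X" for B
    unfolding X[abs_def] cscale_def by (intro continuous_intros)
  show "continuous_on A X"
    by (rule X_cont)
  show "fourier_coeff X (int m) = 0" if m: "m \<ge> 2"
  proof -
    have cont: "continuous_on {0..2 * pi} (\<lambda>\<theta>. cscale (cis (- of_int (int m) * \<theta>)) (X \<theta>))"
      unfolding cscale_def by (intro continuous_intros X_cont)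
    have "integral {0..2 * pi} (\<lambda>\<theta>. cscale (cis (- of_int (int m) * \<theta>)) (X \<theta>)) $ i $ j = 0" for i j
    proof -
      have "bounded_linear (\<lambda>A :: complex^'n^'n. A $ i $ j)"
        by (intro bounded_linear_compose[OF bounded_linear_vec_nth bounded_linear_vec_nth])
      from integral_linear[OF integrable_continuous_interval[OF cont] this]
      have "integral {0..2 * pi} (\<lambda>\<theta>. cscale (cis (- of_int (int m) * \<theta>)) (X \<theta>)) $ i $ j
          = integral {0..2 * pi} (\<lambda>\<theta>. cscale (cis (- of_int (int m) * \<theta>)) (X \<theta>) $ i $ j)"
        by (simp add: o_def)
      also have "\<dots> = integral {0..2 * pi} (\<lambda>\<theta>. cis (- (real (m - 1) * \<theta>)) * H (cis \<theta>) $ i $ j)"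
      proof -
        \<comment> \<open>The factor \<lambda> shifts the index: coefficient \<open>m\<close> of
          \<open>X\<close> is coefficient \<open>m - 1\<close> of \<open>H\<close> on the circle, a
          positive index exactly when \<open>m \<ge> 2\<close>.\<close>
        have "cis (- of_int (int m) * \<theta>) * cis \<theta> = cis (- (real (m - 1) * \<theta>))" for \<theta>
          using m by (simp add: cis_mult of_nat_diff algebra_simps)
        then show ?thesis
          by (simp add: X cscale_def mult.assoc[symmetric])
      qed
      also have "\<dots> = 0"
        using m
        by (intro outside_positive_coeff[OF _ _ tendsto_vec_nth[OF tendsto_vec_nth[OF H_lim]]]
            continuous_on_component H_cont H_hol) simp
      finally show ?thesis .
    qed
    then have "integral {0..2 * pi} (\<lambda>\<theta>. cscale (cis (- of_int (int m) * \<theta>)) (X \<theta>)) = 0"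
      by (simp add: vec_eq_iff)
    then show ?thesis
      by (simp add: fourier_coeff_def)
  qed
qed

end

text \<open>Neither \<open>f\<close> nor the sign of the exponent of \<open>k\<close> is built in:
  the locale is interpreted for \<open>k\<close> and for its inverse, and its lemmas are applied to
  \<open>f\<close> and to \<open>loop_conj k f\<close>. One inclusion of domains thus yields
  both.\<close>

locale conjugated_scattering = closed_matrix_group G
  for G :: "(complex^'n::finite^'n) set" +
  fixes J :: "nat \<Rightarrow> 'n loop" and a k :: "complex^'n^'n"
  assumes J: "vacuum_sequence (lie_algebra G) J" and J1: "J 1 = (\<lambda>\<theta>. cscale (cis \<theta>) a)"
    and k: "k \<in> centralizer_in G a"
begin

lemma kG: "k \<in> G" "invertible k"
  using k invertible by (auto simp: centralizer_in_def)

lemma conj_shifted_flow: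
  assumes "f \<in> L_minus G"
  shows "loop_conj k (loop_mult (vacuum_flow J N t) (loop_inv f))
    = loop_mult (vacuum_flow J N t) (loop_inv (loop_conj k f))"
  by (simp only: loop_conj_mult[OF kG(2)] vacuum_flow_conj[OF k J1 J]
      loop_conj_inv[OF kG(2) L_minus_invertible[OF assms]])

lemma is_factor_conj:
  assumes f: "f \<in> L_minus G" and M: "is_factor G J N f t M"
  shows "is_factor G J N (loop_conj k f) t (loop_conj k M)"
proof -
  obtain E where M_mem: "M \<in> L_minus G" and E: "E \<in> L_plus G"
    "loop_mult (vacuum_flow J N t) (loop_inv f) = loop_mult (loop_inv M) E"
    using M by (auto simp: is_factor_def)
  have "loop_mult (vacuum_flow J N t) (loop_inv (loop_conj k f))
      = loop_mult (loop_inv (loop_conj k M)) (loop_conj k E)"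
    using arg_cong[OF E(2), of "loop_conj k"]
    by (simp only: conj_shifted_flow[OF f])
      (simp only: loop_conj_mult[OF kG(2)] loop_conj_inv[OF kG(2) L_minus_invertible[OF M_mem]])
  then show ?thesis
    using loop_conj_L_minus[OF kG(1) M_mem] loop_conj_L_plus[OF kG(1) E(1)]
    unfolding is_factor_def by blast
qed

lemma scattering_domain_subset:
  "f \<in> L_minus G \<Longrightarrow> scattering_domain G J N f \<subseteq> scattering_domain G J N (loop_conj k f)"
  using is_factor_conj unfolding scattering_domain_def by blast

lemma scattering_solution_conj:
  assumes f: "f \<in> L_minus G" and t: "t \<in> scattering_domain G J N f"
  shows "scattering_solution G J N (loop_conj k f) t = loop_conj k (scattering_solution G J N f t)"
proof -
  obtain M where M: "is_factor G J N f t M"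
    using t by (auto simp: scattering_domain_def)
  then have M_mem: "M \<in> L_minus G"
    by (simp add: is_factor_def)
  \<comment> \<open>Existence comes from \<open>M\<close> and its conjugate, uniqueness from
    \<open>factor_unique\<close>; this evaluates both definite descriptions.\<close>
  have factors: "scattering_factor G J N f t = M"
    "scattering_factor G J N (loop_conj k f) t = loop_conj k M"
    unfolding scattering_factor_def using M is_factor_conj[OF f M]
    by (blast intro: factor_unique)+
  let ?X = "loop_mult (loop_mult M (J 1)) (loop_inv M)"
  have J1_conj: "loop_conj k (J 1) = J 1"
  proof -
    have "k ** a ** matrix_inv k = a"
      using k matrix_inv[OF kG(2)] by (simp add: centralizer_in_def flip: matrix_mul_assoc)
    then show ?thesis
      by (simp only: J1 loop_conj_def cscale_conj[symmetric])
  qed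
  have "loop_conj k ?X = loop_mult (loop_mult (loop_conj k M) (J 1)) (loop_inv (loop_conj k M))"
    by (simp only: loop_conj_mult[OF kG(2)] J1_conj loop_conj_inv[OF kG(2) L_minus_invertible[OF M_mem]])
  moreover have "plus_part (loop_conj k ?X) = loop_conj k (plus_part ?X)"
    using fourier_coeff_dressed[OF M_mem J1] by (rule plus_part_conj)
  ultimately have "plus_part (loop_mult (loop_mult (loop_conj k M) (J 1)) (loop_inv (loop_conj k M)))
      = loop_conj k (plus_part ?X)"
    by simp
  \<comment> \<open>The subtracted term \<open>J 1\<close> is also rewritten as a conjugate, so that
    conjugation distributes over the whole difference.\<close>
  moreover have "J 1 \<theta> = k ** J 1 \<theta> ** matrix_inv k" for \<theta>
    using fun_cong[OF J1_conj, of \<theta>] by (simp add: loop_conj_def)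
  ultimately show ?thesis
    unfolding scattering_solution_def factors Let_def
    by (simp add: fun_eq_iff loop_conj_def matmul.diff_left matmul.diff_right)
qed

lemma tau_conj:
  assumes "f \<in> L_minus G" "connected G" "csubspace (lie_algebra G)" "invariant_form (lie_algebra G) B"
  shows "tau G B J N (loop_conj k f) = tau G B J N f"
  unfolding tau_def conj_shifted_flow[OF assms(1), symmetric]
  by (rule ext, rule mu_conj[OF assms(2-4) kG(1)])

end

text \<open>Quantifying the equivalence over all \<open>d\<close> states that one logarithmic
  derivative exists exactly when the other does, with the same value. Since the domains and the tau
  functions coincide, both sides are the same proposition.\<close>

theorem theorem4p9:
  fixes G :: "(complex^'n^'n) set"
    and B :: "complex^'n^'n \<Rightarrow> complex^'n^'n \<Rightarrow> complex"
    and J :: "nat \<Rightarrow> 'n loop"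
    and a k :: "complex^'n^'n"
    and f :: "'n loop"
  assumes "complex_semisimple_matrix_group G"
    and "invariant_form (lie_algebra G) B"
    and "integral_class G B"
    and "regular_element (lie_algebra G) a"
    and "vacuum_sequence (lie_algebra G) J"
    and "J 1 = (\<lambda>\<theta>. cscale (cis \<theta>) a)"
    and "k \<in> centralizer_in G a"
    and "f \<in> L_minus G"
  shows "loop_conj k f \<in> L_minus G \<and>
    (\<forall>N. scattering_domain G J N (loop_conj k f) = scattering_domain G J N f \<and>
      (\<forall>t\<in>scattering_domain G J N f.
        scattering_solution G J N (loop_conj k f) t =
          loop_conj k (scattering_solution G J N f t))) \<and>
    (\<forall>N. \<forall>j\<in>{1..N}. \<forall>t\<in>scattering_domain G J N f. \<forall>d.
      has_ln_second_partial N (scattering_domain G J N f) (tau G B J N f) 1 j t d \<longleftrightarrow>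
      has_ln_second_partial N (scattering_domain G J N (loop_conj k f))
        (tau G B J N (loop_conj k f)) 1 j t d)"
proof -
  interpret closed_matrix_group G
    using assms(1) by unfold_locales (auto simp: complex_semisimple_matrix_group_def)
  interpret K: conjugated_scattering G J a k
    using assms by unfold_locales
  interpret K': conjugated_scattering G J a "matrix_inv k"
    using assms centralizer_inv by unfold_locales
  have conj_mem: "loop_conj k f \<in> L_minus G"
    by (rule loop_conj_L_minus[OF K.kG(1) assms(8)])
  \<comment> \<open>The reverse inclusion is that of \<open>K'\<close> for the data
    \<open>loop_conj k f\<close>, since conjugating back with the inverse returns
    \<open>f\<close>.\<close>
  have "scattering_domain G J N (loop_conj k f) = scattering_domain G J N f" for N
    using K.scattering_domain_subset[OF assms(8)] K'.scattering_domain_subset[OF conj_mem]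
    by (simp add: loop_conj_matrix_inv K.kG(2) subset_antisym)
  moreover have "tau G B J N (loop_conj k f) = tau G B J N f" for N
    using assms(1,2) by (intro K.tau_conj assms(8)) (auto simp: complex_semisimple_matrix_group_def)
  ultimately show ?thesis
    using conj_mem K.scattering_solution_conj[OF assms(8)] by simp
qed

end
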